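(* Let $\boldsymbol a=(a_k)_{k\ge1}$ satisfy $1/2<\underline a\le a_k\le\overline a<1$ for all $k$. Let $h(x)=\max\{1-|x-1|,0\}$, $g=(0,h)^T$, and for $t=(t_k)_{k\ge1}\in[0,1]^{\mathbb N}$ let $$A_0^{[k]}=\begin{pmatrix}a_k&0\\0&1/2\end{pmatrix},\quad A_1^{[k]}=\begin{pmatrix}0&0\\0&1\end{pmatrix},\quad A_2^{[k]}=\begin{pmatrix}0&t_k\\0&1/2\end{pmatrix},\qquad (V_kf)(x)=\sum_{j=0}^2A_j^{[k]}f(2x-j).$$ Set $$w_k=\prod_{i=1}^{k-1}a_i,\qquad L_j=\sum_{i=1}^j\log_2a_i^{-1},\qquad L_0=0,$$ $$\phi_t(x)=\sum_{k\ge1}w_kt_k\,h(2^kx-2),\qquad \Phi_t=(\phi_t,h)^T,\qquad \mathcal C_{\boldsymbol a}=\{\phi_t:t\in[0,1]^{\mathbb N}\}.$$ Then for all $t,s\in[0,1]^{\mathbb N}$ and $n\ge1$, $$\|V_1\cdots V_ng-\Phi_t\|_\infty\le w_{n+1},\qquad \|\phi_t-\phi_s\|_\infty=\sup_{k\ge1}w_k|t_k-s_k|,$$ and the chronological radius (with respect to the constant matching map $P=(0,1,0,1)$) satisfies $$\rho_{\rm ch}=2^{-\lambda_{\rm u}},\qquad \lambda_{\rm u}:=\lim_{m\to\infty}\inf_{r\ge1}\frac1m\sum_{i=r}^{r+m-1}\log_2a_i^{-1},\qquad \rho_{\rm ch}\le\overline a<1.$$ For $X:=\log_2\varepsilon^{-1}>1$,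 $$H_\varepsilon(\mathcal C_{\boldsymbol a})=\sum_{j\ge0}(X-1-L_j)_++R(X),\qquad 0\le R(X)\le\frac1{(1-\overline a)\ln2}.$$ Moreover, if $L_n/n\to\lambda$ as $n\to\infty$, then $$H_\varepsilon(\mathcal C_{\boldsymbol a})=\frac{X^2}{2\lambda}+o(X^2)\qquad(\varepsilon\downarrow0),$$ and the remainder is $O(X)$ if $\sup_n|L_n-\lambda n|<\infty$. If all $a_k$ are rational and $\boldsymbol a$ is generated by a fixed algorithm, then at shared dyadic accuracies $\varepsilon$ the optimal bit budget $\lceil H_\varepsilon(\mathcal C_{\boldsymbol a})\rceil$ for deterministic fixed-length codes of worst-case distortion at most $\varepsilon$ is attained by a code whose reconstructions are computed exactly by ReLU networks with rational parameters, of width $O(1)$ and with depth and number of parameters $O(X)$.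
   Context: Conventions. $(u)_+=\max\{u,0\}$; $\|f\|_\infty=\sup_{x\in\mathbb R}\max_i|f_i(x)|$. In $V_1\cdots V_ng$ the rightmost operator acts first. A ReLU network consists of affine maps separated by coordinatewise activations $t\mapsto\max\{t,0\}$ with an affine output layer; width is the largest hidden dimension, depth the number of hidden layers, and the parameter count includes all affine entries. Chronological radius. For $\epsilon\in\{0,1\}$ let $T^{[k]}_\epsilon\in\mathbb R^{4\times4}$ have $2\times2$ blocks $[T^{[k]}_\epsilon]_{i\ell}=A^{[k]}_{2i-\ell-1+\epsilon}$, $i,\ell\in\{1,2\}$ (with $A_j^{[k]}=0$ for $j\notin\{0,1,2\}$). Let $U$ have columns forming an orthonormal basis of $\ker P\subset\mathbb R^4$ and $C_{k,\epsilon}=U^TT_\epsilon^{[k]}U$. Then $\rho_{\rm ch}=\lim_{m\to\infty}\chi_m^{1/m}$ with $\chi_m=\sup_{b\ge1}\max_{\epsilon_b,\dots,\epsilon_{b+m-1}\in\{0,1\}}\|C_{b,\epsilon_b}\cdots C_{b+m-1,\epsilon_{b+m-1}}\|$ (it is independent of the norm and of the basis). Entropy and codes. For a compact function class $\mathcal C$, $N(\varepsilon,\mathcal C)$ is the minimal number of closed uniform-norm balls of radius $\varepsilon$, with arbitrary bounded functions as centers, covering $\mathcal C$, and $H_\varepsilon(\mathcal C)=\log_2N(\varepsilon,\mathcal C)$. A deterministic fixed-length code of bit length $B$ is an encoder $E:\mathcal C\to\{0,1\}^B$ together with a decoder $R$ from $\{0,1\}^B$ to bounded functions; its worst-case distortion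 is $\sup_{f\in\mathcal C}\|f-R(E(f))\|_\infty$. The decoder, the accuracy $\varepsilon$ and the description of $\boldsymbol a$ are shared and not counted in the bit length; no bound on decoder running time is asserted. Dyadic accuracies are dyadic rational values of $\varepsilon$. "Generated by a fixed algorithm" means $k\mapsto a_k\in\mathbb Q$ is computable. Implied constants may depend on $\boldsymbol a$. *)

theory Defs
  imports "HOL-Analysis.Analysis" "HOL-Library.Landau_Symbols"
begin

text \<open>
  The sequences \<open>a\<close>, \<open>t\<close>, the weights and the masks are indexed by \<open>k \<ge> 1\<close>; their values at \<open>0\<close>
  are junk and never enter.
\<close>

section \<open>Uniform norm\<close>

text \<open>
  On \<^typ>\<open>real\<close> the library's \<^const>\<open>infnorm\<close> is the absolute value, on \<^typ>\<open>real^2\<close> it is the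
  largest absolute value of a coordinate. The supremum is taken in \<^typ>\<open>ereal\<close>, so it is
  meaningful for unbounded functions, too.
\<close>

definition unif_norm :: "(real \<Rightarrow> 'a::euclidean_space) \<Rightarrow> ereal" where
  "unif_norm f = (SUP x. ereal (infnorm (f x)))"


section \<open>Subdivision operators and the chronological radius\<close>

type_synonym masks = "nat \<Rightarrow> int \<Rightarrow> real^2^2"

definition subdiv_op :: "masks \<Rightarrow> nat \<Rightarrow> (real \<Rightarrow> real^2) \<Rightarrow> real \<Rightarrow> real^2" where
  "subdiv_op A k f x = (\<Sum>j\<in>{0..2::int}. A k j *v f (2 * x - of_int j))"

text \<open>
  Coordinate \<open>r \<in> {1,2,3,4}\<close> of \<open>\<real>\<^sup>4\<close> is coordinate \<open>block_pos r\<close> of the block \<open>block_idx r\<close>.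
  The largest element of the index type is written \<open>4\<close>, which is also its \<open>0\<close>.
\<close>

definition block_idx :: "4 \<Rightarrow> int" where
  "block_idx r = (if r = 1 \<or> r = 2 then 1 else 2)"

definition block_pos :: "4 \<Rightarrow> 2" where
  "block_pos r = (if r = 1 \<or> r = 3 then 1 else 2)"

definition transition_mat :: "masks \<Rightarrow> nat \<Rightarrow> int \<Rightarrow> real^4^4" where
  "transition_mat A k e =
     (\<chi> r c. A k (2 * block_idx r - block_idx c - 1 + e) $ block_pos r $ block_pos c)"

definition orthonormal_kernel_basis :: "real^4^1 \<Rightarrow> real^3^4 \<Rightarrow> bool" where
  "orthonormal_kernel_basis P U \<longleftrightarrow>
     (\<forall>i j. column i U \<bullet> column j U = (if i = j then 1 else 0)) \<and>
     span (columns U) = {v. P *v v = 0}"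

definition restricted_mat :: "masks \<Rightarrow> real^3^4 \<Rightarrow> nat \<Rightarrow> int \<Rightarrow> real^3^3" where
  "restricted_mat A U k e = transpose U ** transition_mat A k e ** U"

definition is_norm :: "('a::real_vector \<Rightarrow> real) \<Rightarrow> bool" where
  "is_norm N \<longleftrightarrow>
     (\<forall>x. N x = 0 \<longleftrightarrow> x = 0) \<and>
     (\<forall>c x. N (c *\<^sub>R x) = \<bar>c\<bar> * N x) \<and>
     (\<forall>x y. N (x + y) \<le> N x + N y)"

definition chron_max :: "(real^3^3 \<Rightarrow> real) \<Rightarrow> masks \<Rightarrow> real^3^4 \<Rightarrow> nat \<Rightarrow> nat \<Rightarrow> real" where
  "chron_max N A U m b =
     Max ((\<lambda>e. N (foldr (**) (map (\<lambda>i. restricted_mat A U i (e i)) [b..<b + m]) (mat 1)))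
          ` ({b..<b + m} \<rightarrow>\<^sub>E {0, 1}))"

definition chron_sup :: "(real^3^3 \<Rightarrow> real) \<Rightarrow> masks \<Rightarrow> real^3^4 \<Rightarrow> nat \<Rightarrow> real" where
  "chron_sup N A U m = (SUP b\<in>{1..}. chron_max N A U m b)"

definition chron_radius :: "(real^3^3 \<Rightarrow> real) \<Rightarrow> masks \<Rightarrow> real^3^4 \<Rightarrow> real" where
  "chron_radius N A U = lim (\<lambda>m. root m (chron_sup N A U m))"


section \<open>The family\<close>

definition hat :: "real \<Rightarrow> real" where
  "hat x = max (1 - \<bar>x - 1\<bar>) 0"

definition gvec :: "real \<Rightarrow> real^2" where
  "gvec x = vector [0, hat x]"

definition unit_seqs :: "(nat \<Rightarrow> real) set" where
  "unit_seqs = {t. \<forall>k\<ge>1. 0 \<le> t k \<and> t k \<le> 1}"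

definition level_mask :: "(nat \<Rightarrow> real) \<Rightarrow> (nat \<Rightarrow> real) \<Rightarrow> masks" where
  "level_mask a t k j =
     (if j = 0 then vector [vector [a k, 0], vector [0, 1/2]]
      else if j = 1 then vector [vector [0, 0], vector [0, 1]]
      else if j = 2 then vector [vector [0, t k], vector [0, 1/2]]
      else 0)"

definition matching_map :: "real^4^1" where
  "matching_map = (\<chi> i. vector [0, 1, 0, 1])"

definition weight :: "(nat \<Rightarrow> real) \<Rightarrow> nat \<Rightarrow> real" where
  "weight a k = (\<Prod>i\<in>{1..<k}. a i)"

definition logsum :: "(nat \<Rightarrow> real) \<Rightarrow> nat \<Rightarrow> real" where
  "logsum a j = (\<Sum>i=1..j. log 2 (inverse (a i)))"

text \<open>The \<open>i\<close>-th term is the one with index \<open>k = Suc i\<close>.\<close>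

definition phi_term :: "(nat \<Rightarrow> real) \<Rightarrow> (nat \<Rightarrow> real) \<Rightarrow> real \<Rightarrow> nat \<Rightarrow> real" where
  "phi_term a t x i = weight a (Suc i) * t (Suc i) * hat (2 ^ Suc i * x - 2)"

definition phi :: "(nat \<Rightarrow> real) \<Rightarrow> (nat \<Rightarrow> real) \<Rightarrow> real \<Rightarrow> real" where
  "phi a t x = (\<Sum>i. phi_term a t x i)"

definition Phi :: "(nat \<Rightarrow> real) \<Rightarrow> (nat \<Rightarrow> real) \<Rightarrow> real \<Rightarrow> real^2" where
  "Phi a t x = vector [phi a t x, hat x]"

definition phi_class :: "(nat \<Rightarrow> real) \<Rightarrow> (real \<Rightarrow> real) set" where
  "phi_class a = phi a ` unit_seqs"

definition lower_mean :: "(nat \<Rightarrow> real) \<Rightarrow> nat \<Rightarrow> real" where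
  "lower_mean a m = (INF r\<in>{1..}. (1 / real m) * (\<Sum>i\<in>{r..<r + m}. log 2 (inverse (a i))))"

definition lambda_u :: "(nat \<Rightarrow> real) \<Rightarrow> real" where
  "lambda_u a = lim (lower_mean a)"


section \<open>Entropy and codes\<close>

definition ball_cover :: "real \<Rightarrow> (real \<Rightarrow> real) set \<Rightarrow> (real \<Rightarrow> real) set \<Rightarrow> bool" where
  "ball_cover \<epsilon> C F \<longleftrightarrow>
     finite F \<and> (\<forall>c\<in>F. bounded (range c)) \<and>
     (\<forall>f\<in>C. \<exists>c\<in>F. unif_norm (\<lambda>x. f x - c x) \<le> ereal \<epsilon>)"

definition covering_number :: "real \<Rightarrow> (real \<Rightarrow> real) set \<Rightarrow> nat" where
  "covering_number \<epsilon> C = (LEAST n. \<exists>F. ball_cover \<epsilon> C F \<and> card F = n)"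

definition entropy :: "real \<Rightarrow> (real \<Rightarrow> real) set \<Rightarrow> real" where
  "entropy \<epsilon> C = log 2 (real (covering_number \<epsilon> C))"

definition fixed_length_code ::
  "(real \<Rightarrow> real) set \<Rightarrow> nat \<Rightarrow> ((real \<Rightarrow> real) \<Rightarrow> bool list) \<Rightarrow> (bool list \<Rightarrow> real \<Rightarrow> real) \<Rightarrow> bool"
  where
  "fixed_length_code C B E R \<longleftrightarrow>
     (\<forall>f\<in>C. length (E f) = B) \<and> (\<forall>\<sigma>. length \<sigma> = B \<longrightarrow> bounded (range (R \<sigma>)))"

definition distortion ::
  "(real \<Rightarrow> real) set \<Rightarrow> ((real \<Rightarrow> real) \<Rightarrow> bool list) \<Rightarrow> (bool list \<Rightarrow> real \<Rightarrow> real) \<Rightarrow> ereal" where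
  "distortion C E R = (SUP f\<in>C. unif_norm (\<lambda>x. f x - R (E f) x))"

definition optimal_bits :: "real \<Rightarrow> (real \<Rightarrow> real) set \<Rightarrow> nat" where
  "optimal_bits \<epsilon> C = (LEAST B. \<exists>E R. fixed_length_code C B E R \<and> distortion C E R \<le> ereal \<epsilon>)"

definition dyadic :: "real \<Rightarrow> bool" where
  "dyadic x \<longleftrightarrow> (\<exists>(p::int) (n::nat). x = of_int p / 2 ^ n)"


section \<open>ReLU networks\<close>

text \<open>
  An affine layer is a list of weight rows together with a bias vector; the last layer of a network
  is the affine output layer, all earlier ones are hidden layers.
\<close>

type_synonym layer = "real list list \<times> real list"

definition layer_apply :: "layer \<Rightarrow> real list \<Rightarrow> real list" where
  "layer_apply l x = map2 (\<lambda>row b. sum_list (map2 (*) row x) + b) (fst l) (snd l)"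

fun net_apply :: "layer list \<Rightarrow> real list \<Rightarrow> real list" where
  "net_apply [] x = x"
| "net_apply [l] x = layer_apply l x"
| "net_apply (l # l' # ls) x = net_apply (l' # ls) (map (\<lambda>u. max u 0) (layer_apply l x))"

text \<open>Consistent dimensions, with input dimension \<open>d\<close> and output dimension \<open>d'\<close>.\<close>

fun net_dims :: "nat \<Rightarrow> layer list \<Rightarrow> nat \<Rightarrow> bool" where
  "net_dims d [] d' \<longleftrightarrow> d = d'"
| "net_dims d (l # ls) d' \<longleftrightarrow>
     length (fst l) = length (snd l) \<and> (\<forall>row\<in>set (fst l). length row = d) \<and>
     net_dims (length (snd l)) ls d'"

definition net_computes :: "layer list \<Rightarrow> (real \<Rightarrow> real) \<Rightarrow> bool" where
  "net_computes ls f \<longleftrightarrow> ls \<noteq> [] \<and> net_dims 1 ls 1 \<and> (\<forall>x. net_apply ls [x] = [f x])"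

definition net_depth :: "layer list \<Rightarrow> nat" where
  "net_depth ls = length (butlast ls)"

definition net_width :: "layer list \<Rightarrow> nat" where
  "net_width ls = Max (insert 0 ((\<lambda>l. length (snd l)) ` set (butlast ls)))"

definition net_params :: "layer list \<Rightarrow> nat" where
  "net_params ls = (\<Sum>l\<leftarrow>ls. sum_list (map length (fst l)) + length (snd l))"

definition net_rational :: "layer list \<Rightarrow> bool" where
  "net_rational ls \<longleftrightarrow>
     (\<forall>l\<in>set ls. (\<forall>row\<in>set (fst l). set row \<subseteq> \<rat>) \<and> set (snd l) \<subseteq> \<rat>)"


section \<open>Computable sequences of rationals\<close>

text \<open>
  Kleene's partial recursive functions: \<open>rec_eval c xs y\<close> says that the program \<open>c\<close> on input \<open>xs\<close>
  terminates with output \<open>y\<close>.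
\<close>

datatype recf =
    RZero | RSucc | RProj nat | RComp recf "recf list" | RPrim recf recf | RMin recf

inductive rec_eval :: "recf \<Rightarrow> nat list \<Rightarrow> nat \<Rightarrow> bool" where
  "rec_eval RZero xs 0"
| "rec_eval RSucc [x] (Suc x)"
| "i < length xs \<Longrightarrow> rec_eval (RProj i) xs (xs ! i)"
| "length ys = length gs \<Longrightarrow> (\<forall>i<length gs. rec_eval (gs ! i) xs (ys ! i)) \<Longrightarrow>
     rec_eval f ys z \<Longrightarrow> rec_eval (RComp f gs) xs z"
| "rec_eval f xs y \<Longrightarrow> rec_eval (RPrim f g) (0 # xs) y"
| "rec_eval (RPrim f g) (n # xs) y \<Longrightarrow> rec_eval g (n # y # xs) z \<Longrightarrow>
     rec_eval (RPrim f g) (Suc n # xs) z"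
| "rec_eval f (n # xs) 0 \<Longrightarrow> (\<forall>m<n. \<exists>y. rec_eval f (m # xs) (Suc y)) \<Longrightarrow>
     rec_eval (RMin f) xs n"

definition computable_nat :: "(nat \<Rightarrow> nat) \<Rightarrow> bool" where
  "computable_nat f \<longleftrightarrow> (\<exists>c. \<forall>n y. rec_eval c [n] y \<longleftrightarrow> y = f n)"

text \<open>A sequence of rationals is computable if its signs, numerators and denominators are.\<close>

definition computable_rat_seq :: "(nat \<Rightarrow> real) \<Rightarrow> bool" where
  "computable_rat_seq a \<longleftrightarrow>
     (\<exists>s p q. computable_nat s \<and> computable_nat p \<and> computable_nat q \<and>
        (\<forall>k\<ge>1. q k \<noteq> 0 \<and> a k = (-1) ^ s k * real (p k) / real (q k)))"

end

theory Submission
  imports Defs "HOL-Real_Asymp.Real_Asymp"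
begin

text \<open>
  The bumps \<open>hat (2\<^sup>k x - 2)\<close> have disjoint supports, so \<open>t \<mapsto> \<phi>\<^sub>t\<close> is an isometry from the box
  \<open>\<Prod>\<^sub>k [0, w\<^sub>k]\<close> with the supremum metric. Hence the covering number is exactly
  \<open>\<Prod>\<^sub>k \<lceil>w\<^sub>k / (2 \<epsilon>)\<rceil>\<close>: midpoints of equal subdivisions cover, and endpoints of the subdivisions
  with one cell less are more than \<open>2 \<epsilon>\<close> apart. Taking logarithms yields the entropy formula, the excess
  of the ceilings being dominated by a geometric series, and a midpoint is a sum of \<open>O(X)\<close> bumps,
  each produced by one ReLU layer of width five. On the kernel of the matching map the only growth
  is that of the products of the \<open>a\<^sub>i\<close>, since the remaining eigenvalue \<open>1/2\<close> is smaller; Fekete's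
  lemma then gives the chronological radius.
\<close>

section \<open>Hat functions\<close>

text \<open>The count is exact because the ceiling is strict: with y = w_k / (2 \<epsilon>) rounded
  up to n > 1, n - 1 < y, so points at spacing w_k / (n - 1) are more than 2 \<epsilon> apart and no
  closed ball of radius \<epsilon> holds two of them. Centres are arbitrary functions, so they are
  compared only at the peaks 3 / 2^k, where a single coordinate of t is visible. The 1 in X - 1 -
  L_j is the logarithm of the factor 2 in the diameter 2 \<epsilon>. The remainder constant arises
  from log2 n - log2 y \<le> 1 / (y ln 2): going back from the last level with y > 1, the values 1 /
  y shrink at least by the factor \<open>a_hi\<close> per level and sum to at most 1 / (1 - a_hi).
  For the radius, basis and norm are arbitrary. On the invariant kernel U U^T is the identity, so
  the restricted products reduce to orbits in R^4; norm and basis then cost only constants, which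
  the m-th root removes.\<close>

lemma hat_nonneg: "0 \<le> hat x" and hat_le_1: "hat x \<le> 1"
  by (auto simp: hat_def)

lemma hat_eq_0: "x \<le> 0 \<or> 2 \<le> x \<Longrightarrow> hat x = 0"
  by (auto simp: hat_def)

text \<open>Two-scale relation of the linear B-spline. The coefficients 1/2, 1, 1/2 are the lower
  right mask entries, so every \<open>subdiv_op\<close> reproduces a second component
  \<open>hat\<close>.\<close>

lemma hat_refinement: "hat x = hat (2 * x) / 2 + hat (2 * x - 1) + hat (2 * x - 2) / 2"
  unfolding hat_def by (smt (z3) field_sum_of_halves)

text \<open>A second difference of ReLU pieces, shifted so that y can be 2^k x.\<close>

lemma hat_eq_relu: "hat (y - 2) = max (y - 2) 0 - 2 * max (y - 3) 0 + max (y - 4) 0"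
  by (auto simp: hat_def max_def abs_if)

text \<open>Bump k lives on 2 < 2^k x < 4. For such x a coarser level has 2^l x below 2, a finer one
  above 4.\<close>

lemma hat_dyadic_disjoint:
  assumes "hat (2 ^ k * x - 2) \<noteq> 0" "l \<noteq> k"
  shows "hat (2 ^ l * x - 2) = 0"
proof -
  have k: "2 < 2 ^ k * x" "2 ^ k * x < 4"
    using assms(1) hat_eq_0[of "2 ^ k * x - 2"] by linarith+
  then have x: "0 < x"
    using zero_less_mult_pos[of "2 ^ k" x] by simp
  show ?thesis
  proof (cases "l < k")
    case True
    then have "(2::real) ^ Suc l \<le> 2 ^ k"
      by (intro power_increasing) auto
    then have "2 ^ Suc l * x \<le> 2 ^ k * x"
      using x by simp
    with k show ?thesis
      by (intro hat_eq_0) auto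
  next
    case False
    with \<open>l \<noteq> k\<close> have "(2::real) ^ Suc k \<le> 2 ^ l"
      by (intro power_increasing) auto
    then have "2 ^ Suc k * x \<le> 2 ^ l * x"
      using x by simp
    with k show ?thesis
      by (intro hat_eq_0) auto
  qed
qed

text \<open>Where no bump is active, level 1 serves as k, so later arguments need no case
  distinction.\<close>

lemma active_level:
  fixes x :: real
  obtains k :: nat where "k \<ge> 1" "\<And>l. l \<ge> 1 \<Longrightarrow> l \<noteq> k \<Longrightarrow> hat (2 ^ l * x - 2) = 0"
proof (cases "\<exists>k\<ge>1. hat (2 ^ k * x - 2) \<noteq> 0")
  case True
  then show ?thesis
    using hat_dyadic_disjoint that by metis
next
  case False
  then show ?thesis
    using that[of 1] by auto
qed


section \<open>The weights and the functions \<open>\<phi>\<^sub>t\<close>\<close>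

lemma unif_norm_le_iff: "unif_norm f \<le> ereal c \<longleftrightarrow> (\<forall>x. infnorm (f x) \<le> c)"
  by (auto simp: unif_norm_def SUP_le_iff)

lemma infnorm_real: "infnorm (x :: real) = \<bar>x\<bar>"
  by (simp add: infnorm_Max)

lemma weight_1 [simp]: "weight a (Suc 0) = 1"
  by (simp add: weight_def)

lemma weight_Suc: "1 \<le> k \<Longrightarrow> weight a (Suc k) = weight a k * a k"
  by (simp add: weight_def)

lemma phi_active_level:
  assumes "k \<ge> 1" "\<And>l. l \<ge> 1 \<Longrightarrow> l \<noteq> k \<Longrightarrow> hat (2 ^ l * x - 2) = 0"
  shows "phi_term a t x sums (weight a k * t k * hat (2 ^ k * x - 2))"
    and "phi a t x = weight a k * t k * hat (2 ^ k * x - 2)"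
proof -
  have "phi_term a t x i = (if i = k - 1 then weight a k * t k * hat (2 ^ k * x - 2) else 0)" for i
    using assms(1) assms(2)[of "Suc i"] by (cases k) (auto simp: phi_term_def)
  then have "phi_term a t x = (\<lambda>i. if i = k - 1 then weight a k * t k * hat (2 ^ k * x - 2) else 0)"
    by blast
  then show "phi_term a t x sums (weight a k * t k * hat (2 ^ k * x - 2))"
    using sums_single[of "k - 1" "\<lambda>_. weight a k * t k * hat (2 ^ k * x - 2)"] by simp
  then show "phi a t x = weight a k * t k * hat (2 ^ k * x - 2)"
    unfolding phi_def by (rule sums_unique[symmetric])
qed

lemma summable_phi_term: "summable (phi_term a t x)"
  by (metis active_level phi_active_level(1) sums_summable)

text \<open>The centre of bump k, where all other bumps vanish: evaluation there recovers one
  weighted coordinate. The lower bounds on distances rest on it.\<close>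

lemma phi_peak:
  assumes "k \<ge> 1"
  shows "phi a t (3 / 2 ^ k) = weight a k * t k"
proof -
  have 1: "hat (2 ^ k * (3 / 2 ^ k) - 2) = 1"
    by (simp add: hat_def)
  then have "hat (2 ^ l * (3 / 2 ^ k) - 2) = 0" if "l \<noteq> k" for l
    using hat_dyadic_disjoint[OF _ that, of "3 / 2 ^ k"] by simp
  then show ?thesis
    using phi_active_level(2)[OF assms, of "3 / 2 ^ k" a t] 1 by simp
qed

lemma phi_finite_support:
  assumes "\<And>k. k > K \<Longrightarrow> t k = 0"
  shows "phi a t x = (\<Sum>k=1..K. weight a k * t k * hat (2 ^ k * x - 2))"
proof -
  have "phi a t x = (\<Sum>i<K. phi_term a t x i)"
    unfolding phi_def by (rule suminf_finite) (auto simp: phi_term_def assms)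
  also have "\<dots> = (\<Sum>k=1..K. weight a k * t k * hat (2 ^ k * x - 2))"
    by (rule sum.reindex_bij_witness[of _ "\<lambda>k. k - 1" Suc]) (auto simp: phi_term_def)
  finally show ?thesis .
qed

lemma bounded_range_phi_finite:
  assumes "\<And>k. k > K \<Longrightarrow> t k = 0"
  shows "bounded (range (phi a t))"
proof -
  have "\<bar>phi a t x\<bar> \<le> (\<Sum>k=1..K. \<bar>weight a k * t k\<bar>)" for x
  proof -
    have "\<bar>phi a t x\<bar> \<le> (\<Sum>k=1..K. \<bar>weight a k * t k * hat (2 ^ k * x - 2)\<bar>)"
      using phi_finite_support[of K t a x] assms by (simp add: sum_abs)
    also have "\<dots> \<le> (\<Sum>k=1..K. \<bar>weight a k * t k\<bar>)"
      by (rule sum_mono) (auto simp: abs_mult hat_nonneg hat_le_1 intro!: mult_left_le)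
    finally show ?thesis .
  qed
  then show ?thesis
    by (auto simp: bounded_iff)
qed

section \<open>Iterates of the subdivision operators\<close>

lemma subdiv_op_level_mask:
  "subdiv_op (level_mask a t) k f x =
     vector [a k * f (2 * x) $ 1 + t k * f (2 * x - 2) $ 2,
             f (2 * x) $ 2 / 2 + f (2 * x - 1) $ 2 + f (2 * x - 2) $ 2 / 2]"
proof -
  have "{0..2::int} = {0, 1, 2}"
    by auto
  then show ?thesis
    by (simp add: subdiv_op_def level_mask_def vec_eq_iff forall_2 matrix_vector_mult_def sum_2)
qed

text \<open>The operator of smallest index acts last, so the induction runs downwards from the empty
  list at m = \<open>Suc n\<close>. Each further operator compresses the bumps already present by 2,
  multiplies them by \<open>a m\<close>, and adds one coarser bump with coefficient
  \<open>t m\<close>.\<close>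

lemma foldr_subdiv_op:
  assumes "1 \<le> m" "m \<le> Suc n"
  shows "foldr (subdiv_op (level_mask a t)) [m..<Suc n] gvec x =
     vector [\<Sum>k=m..n. (\<Prod>i=m..<k. a i) * t k * hat (2 ^ (Suc k - m) * x - 2), hat x]"
  using assms(2,1)
proof (induction m arbitrary: x rule: inc_induct)
  case base
  then show ?case
    by (simp add: gvec_def)
next
  case (step m)
  let ?S = "\<lambda>y. \<Sum>k=Suc m..n. (\<Prod>i=Suc m..<k. a i) * t k * hat (2 ^ (k - m) * y - 2)"
  have IH: "foldr (subdiv_op (level_mask a t)) [Suc m..<Suc n] gvec y = vector [?S y, hat y]" for y
    using step.IH[of y] by simp
  have "[m..<Suc n] = m # [Suc m..<Suc n]"
    using step by (simp add: upt_conv_Cons)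
  then have "foldr (subdiv_op (level_mask a t)) [m..<Suc n] gvec x =
      vector [a m * ?S (2 * x) + t m * hat (2 * x - 2), hat x]"
    using hat_refinement[of x] by (simp only: foldr.simps o_def subdiv_op_level_mask IH) simp
  also have "a m * ?S (2 * x) + t m * hat (2 * x - 2) =
      (\<Sum>k=m..n. (\<Prod>i=m..<k. a i) * t k * hat (2 ^ (Suc k - m) * x - 2))"
  proof -
    have "a m * ?S (2 * x) =
        (\<Sum>k=Suc m..n. (\<Prod>i=m..<k. a i) * t k * hat (2 ^ (Suc k - m) * x - 2))"
      unfolding sum_distrib_left
    proof (intro sum.cong refl)
      fix k assume k: "k \<in> {Suc m..n}"
      then have "(\<Prod>i=m..<k. a i) = a m * (\<Prod>i=Suc m..<k. a i)"
        by (simp add: prod.atLeast_Suc_lessThan)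
      moreover have "2 ^ (k - m) * (2 * x) = 2 ^ (Suc k - m) * x"
        using k by (simp add: Suc_diff_le)
      ultimately show "a m * ((\<Prod>i=Suc m..<k. a i) * t k * hat (2 ^ (k - m) * (2 * x) - 2)) =
          (\<Prod>i=m..<k. a i) * t k * hat (2 ^ (Suc k - m) * x - 2)"
        by (simp only: mult.assoc)
    qed
    moreover have "{m..n} = insert m {Suc m..n}"
      using step by auto
    ultimately show ?thesis
      by simp
  qed
  finally show ?case .
qed

section \<open>Weights, cascade error and isometry under the standing bounds\<close>

locale contraction_seq =
  fixes a :: "nat \<Rightarrow> real" and a_lo a_hi :: real
  assumes half_less: "1 / 2 < a_lo" and hi_less_1: "a_hi < 1"
    and a_ge: "1 \<le> k \<Longrightarrow> a_lo \<le> a k" and a_le: "1 \<le> k \<Longrightarrow> a k \<le> a_hi"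
begin

lemma a_gt_half: "1 \<le> k \<Longrightarrow> 1 / 2 < a k"
  using half_less a_ge[of k] by linarith

lemma a_pos: "1 \<le> k \<Longrightarrow> 0 < a k"
  using a_gt_half[of k] by linarith

lemma a_hi_pos: "0 < a_hi"
  using a_pos[of 1] a_le[of 1] by linarith

lemma weight_pos: "0 < weight a k"
  unfolding weight_def by (rule prod_pos) (simp add: a_pos)

lemma weight_Suc_le: "weight a (Suc k) \<le> weight a k"
proof (cases "k = 0")
  case False
  then have "weight a k * a k \<le> weight a k * 1"
    using weight_pos[of k] a_le[of k] hi_less_1 by (intro mult_left_mono) auto
  with False show ?thesis
    by (simp add: weight_Suc)
qed (simp add: weight_def)

lemma weight_antimono: "i \<le> j \<Longrightarrow> weight a j \<le> weight a i"
  by (rule lift_Suc_antimono_le[of "weight a", OF weight_Suc_le])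

lemma weight_le_power: "weight a (Suc k) \<le> a_hi ^ k"
proof (induction k)
  case (Suc k)
  then show ?case
    using weight_pos[of "Suc k"] a_le[of "Suc k"] a_pos[of "Suc k"] a_hi_pos
    by (simp add: weight_Suc mult.commute[of a_hi] mult_mono)
qed simp

lemma powr_logsum: "2 powr (- logsum a j) = weight a (Suc j)"
proof (induction j)
  case (Suc j)
  have "2 powr (- log 2 (inverse (a (Suc j)))) = a (Suc j)"
    using a_pos[of "Suc j"] by (simp add: log_inverse)
  then have "2 powr (- logsum a (Suc j)) = weight a (Suc j) * a (Suc j)"
    using Suc by (simp add: logsum_def powr_diff powr_minus divide_inverse)
  then show ?case
    by (simp add: weight_Suc)
qed (simp add: logsum_def)

lemma logsum_eq: "logsum a j = - log 2 (weight a (Suc j))"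
  by (simp flip: powr_logsum)

text \<open>At each x at most one term of the series is active. Either the n-th iterate already
  contains it and the error is 0, or it is the error and its weight is at most
  \<open>weight a (n + 1)\<close>.\<close>

lemma unif_norm_cascade:
  assumes "t \<in> unit_seqs"
  shows "unif_norm (\<lambda>x. foldr (subdiv_op (level_mask a t)) [1..<Suc n] gvec x - Phi a t x)
    \<le> ereal (weight a (n + 1))"
  unfolding unif_norm_le_iff
proof
  fix x
  obtain k where k: "k \<ge> 1" "\<And>l. l \<ge> 1 \<Longrightarrow> l \<noteq> k \<Longrightarrow> hat (2 ^ l * x - 2) = 0"
    by (rule active_level[of x]) blast
  let ?c = "weight a k * t k * hat (2 ^ k * x - 2)"
  have t: "0 \<le> t k" "t k \<le> 1"
    using assms k(1) by (auto simp: unit_seqs_def)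
  have "(\<Sum>l=1..n. weight a l * t l * hat (2 ^ l * x - 2)) =
      (\<Sum>l=1..n. if l = k then ?c else 0)"
    using k by (intro sum.cong) auto
  also have "\<dots> = (if k \<le> n then ?c else 0)"
    using k(1) by simp
  finally have "foldr (subdiv_op (level_mask a t)) [1..<Suc n] gvec x - Phi a t x =
      vector [if k \<le> n then 0 else - ?c, 0]"
    by (simp add: foldr_subdiv_op[of "Suc 0"] weight_def Phi_def phi_active_level(2)[OF k]
        vec_eq_iff forall_2 del: upt_Suc)
  moreover have "?c \<le> weight a (n + 1)" "0 \<le> ?c" if "\<not> k \<le> n"
  proof -
    have "t k * hat (2 ^ k * x - 2) \<le> 1"
      using t by (simp add: hat_nonneg hat_le_1 mult_le_one)
    then have "weight a k * (t k * hat (2 ^ k * x - 2)) \<le> weight a k"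
      using weight_pos[of k] by (simp add: mult_left_le)
    then show "?c \<le> weight a (n + 1)"
      using weight_antimono[of "n + 1" k] that by (simp add: mult.assoc)
    show "0 \<le> ?c"
      using weight_pos[of k] t hat_nonneg by (simp add: less_imp_le)
  qed
  ultimately show "infnorm (foldr (subdiv_op (level_mask a t)) [1..<Suc n] gvec x - Phi a t x)
      \<le> weight a (n + 1)"
    using weight_pos[of "n + 1"] by (auto simp: infnorm_2 simp del: upt_Suc)
qed

text \<open>Only the active level contributes at a point. The bound c is an \<open>ereal\<close> so
  that it can be the supremum itself as well as a covering radius.\<close>

lemma unif_norm_phi_diff_le:
  assumes "\<And>k. 1 \<le> k \<Longrightarrow> ereal (weight a k * \<bar>t k - s k\<bar>) \<le> c"
  shows "unif_norm (\<lambda>x. phi a t x - phi a s x) \<le> c"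
  unfolding unif_norm_def
proof (rule SUP_least)
  fix x
  obtain k where k: "k \<ge> 1" "\<And>l. l \<ge> 1 \<Longrightarrow> l \<noteq> k \<Longrightarrow> hat (2 ^ l * x - 2) = 0"
    by (rule active_level[of x]) blast
  have "\<bar>phi a t x - phi a s x\<bar> = weight a k * \<bar>t k - s k\<bar> * hat (2 ^ k * x - 2)"
    using weight_pos[of k] hat_nonneg[of "2 ^ k * x - 2"]
    by (simp add: phi_active_level(2)[OF k] abs_mult flip: left_diff_distrib right_diff_distrib)
  also have "\<dots> \<le> weight a k * \<bar>t k - s k\<bar>"
    using weight_pos[of k] hat_le_1 hat_nonneg by (intro mult_left_le) auto
  finally show "ereal (infnorm (phi a t x - phi a s x)) \<le> c"
    using assms[OF k(1)]
      order_trans[of "ereal \<bar>phi a t x - phi a s x\<bar>" "ereal (weight a k * \<bar>t k - s k\<bar>)" c]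
    by (simp add: infnorm_real)
qed

lemma unif_norm_phi_diff:
  "unif_norm (\<lambda>x. phi a t x - phi a s x) = (SUP k\<in>{1..}. ereal (weight a k * \<bar>t k - s k\<bar>))"
proof (rule antisym)
  show "unif_norm (\<lambda>x. phi a t x - phi a s x) \<le> (SUP k\<in>{1..}. ereal (weight a k * \<bar>t k - s k\<bar>))"
    by (rule unif_norm_phi_diff_le) (auto intro: SUP_upper)
  show "(SUP k\<in>{1..}. ereal (weight a k * \<bar>t k - s k\<bar>)) \<le> unif_norm (\<lambda>x. phi a t x - phi a s x)"
  proof (rule SUP_least)
    fix k :: nat assume k: "k \<in> {1..}"
    have "weight a k * \<bar>t k - s k\<bar> = infnorm (phi a t (3 / 2 ^ k) - phi a s (3 / 2 ^ k))"
      using k weight_pos[of k]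
      by (simp add: phi_peak infnorm_real abs_mult flip: right_diff_distrib)
    then show "ereal (weight a k * \<bar>t k - s k\<bar>) \<le> unif_norm (\<lambda>x. phi a t x - phi a s x)"
      unfolding unif_norm_def by (auto intro: SUP_upper)
  qed
qed

end


section \<open>Norms on Euclidean spaces and superadditive sequences\<close>

text \<open>Makes the radius independent of the norm. The lower constant is the minimum of N on the
  compact unit sphere, where N is continuous because it is Lipschitz.\<close>

lemma is_norm_equivalent:
  fixes N :: "'a::euclidean_space \<Rightarrow> real"
  assumes "is_norm N"
  obtains c C where "c > 0" "C > 0" "\<And>x. c * norm x \<le> N x" "\<And>x. N x \<le> C * norm x"
proof -
  have zero: "N x = 0 \<longleftrightarrow> x = 0" and scale: "N (r *\<^sub>R x) = \<bar>r\<bar> * N x"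
    and tri: "N (x + y) \<le> N x + N y" for r x y
    using assms by (auto simp: is_norm_def)
  have neg: "N (- x) = N x" for x
    using scale[of "-1" x] by simp
  have nonneg: "0 \<le> N x" for x
    using tri[of x "- x"] zero[of 0] neg[of x] by simp
  have N_sum: "N (sum f B) \<le> (\<Sum>b\<in>B. N (f b))" if "finite B" for f :: "'a \<Rightarrow> 'a" and B
    using that
  proof (induction B rule: finite_induct)
    case (insert b B)
    then show ?case
      using tri[of "f b" "sum f B"] by simp
  qed (use zero[of 0] in simp)
  define C where "C = 1 + (\<Sum>b\<in>Basis. N b)"
  have C: "C > 0"
    using sum_nonneg[of Basis N] nonneg by (simp add: C_def)
  have upper: "N x \<le> C * norm x" for x
  proof -
    have "N x = N (\<Sum>b\<in>Basis. (x \<bullet> b) *\<^sub>R b)"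
      by (simp add: euclidean_representation)
    also have "\<dots> \<le> (\<Sum>b\<in>Basis. N ((x \<bullet> b) *\<^sub>R b))"
      by (rule N_sum) simp
    also have "\<dots> \<le> (\<Sum>b\<in>Basis. N b * norm x)"
      using nonneg by (intro sum_mono) (simp add: scale Basis_le_norm mult_mono mult.commute)
    also have "\<dots> \<le> C * norm x"
      by (simp add: C_def distrib_right flip: sum_distrib_right)
    finally show ?thesis .
  qed
  have "\<bar>N x - N y\<bar> \<le> C * norm (x - y)" for x y
    using tri[of "x - y" y] tri[of "y - x" x] upper[of "x - y"] upper[of "y - x"]
    by (simp add: norm_minus_commute)
  then have "C-lipschitz_on UNIV N"
    using C by (intro lipschitz_onI) (auto simp: dist_norm)
  then have "continuous_on (sphere 0 1) N"
    using lipschitz_on_continuous_on continuous_on_subset by blast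
  moreover have "sphere (0::'a) 1 \<noteq> {}"
    by simp
  ultimately obtain z where z: "z \<in> sphere 0 1" "\<And>y. y \<in> sphere 0 1 \<Longrightarrow> N z \<le> N y"
    using continuous_attains_inf[OF compact_sphere] by metis
  have "N z > 0"
    using z(1) nonneg[of z] zero[of z] by fastforce
  moreover have "N z * norm x \<le> N x" for x
  proof (cases "x = 0")
    case False
    then have "N z \<le> N (inverse (norm x) *\<^sub>R x)"
      by (intro z(2)) simp
    then show ?thesis
      using False by (simp add: scale field_simps)
  qed (use nonneg in simp)
  ultimately show ?thesis
    using that C upper by blast
qed

text \<open>Fekete's lemma: the limit is the supremum of S n / n. Dividing n by m leaves a
  remainder, whose contribution is discarded since S is nonnegative.\<close>

lemma superadditive_convergent:
  fixes S :: "nat \<Rightarrow> real"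
  assumes super: "\<And>m n. S m + S n \<le> S (m + n)" and nonneg: "\<And>n. 0 \<le> S n"
    and bound: "\<And>n. S n \<le> C * real n"
  shows "convergent (\<lambda>n. S n / real n)"
proof -
  define L where "L = (SUP n\<in>{1..}. S n / real n)"
  have bdd: "bdd_above ((\<lambda>n. S n / real n) ` {1..})"
    using bound by (intro bdd_aboveI[of _ C]) (auto simp: divide_le_eq)
  have le_L: "S n / real n \<le> L" if "n \<ge> 1" for n
    unfolding L_def using that bdd by (intro cSUP_upper) auto
  have mult: "real q * S m \<le> S (q * m)" for q m
  proof (induction q)
    case 0
    then show ?case
      using nonneg[of 0] by simp
  next
    case (Suc q)
    then show ?case
      using super[of m "q * m"] by (simp add: algebra_simps)
  qed
  have "(\<lambda>n. S n / real n) \<longlonglongrightarrow> L"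
  proof (rule order_tendstoI)
    fix y assume "y < L"
    then obtain m where m: "m \<ge> 1" "y < S m / real m"
      unfolding L_def by (subst (asm) less_cSUP_iff) (use bdd in auto)
    let ?s = "S m / real m"
    have "(\<lambda>n. ?s - S m / real n) \<longlonglongrightarrow> ?s - 0"
      by (intro tendsto_intros lim_const_over_n)
    then have "\<forall>\<^sub>F n in sequentially. y < ?s - S m / real n"
      using m(2) by (intro order_tendstoD(1)) auto
    then show "\<forall>\<^sub>F n in sequentially. y < S n / real n"
      using eventually_gt_at_top[of 0]
    proof eventually_elim
      case (elim n)
      have "real n = real (n div m) * real m + real (n mod m)"
        by (metis div_mult_mod_eq of_nat_add of_nat_mult)
      moreover have "real (n mod m) \<le> real m"
        using m(1) by (simp add: less_imp_le)
      ultimately have "real n - real m \<le> real (n div m) * real m"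
        by linarith
      then have "(real n - real m) * ?s \<le> real (n div m) * real m * ?s"
        using nonneg[of m] by (intro mult_right_mono) auto
      also have "\<dots> = real (n div m) * S m"
        using m(1) by simp
      also have "\<dots> \<le> S (n div m * m) + S (n mod m)"
        using mult[of "n div m" m] nonneg[of "n mod m"] by linarith
      also have "\<dots> \<le> S n"
        using super[of "n div m * m" "n mod m"] by simp
      finally have "(real n - real m) * ?s / real n \<le> S n / real n"
        using elim(2) by (intro divide_right_mono) auto
      also have "(real n - real m) * ?s / real n = ?s - S m / real n"
        using elim(2) m(1) by (simp add: field_simps)
      finally show ?case
        using elim(1) by simp
    qed
  next
    fix y assume "L < y"
    then show "\<forall>\<^sub>F n in sequentially. S n / real n < y"
      using le_L by (intro eventually_sequentiallyI[of 1]) (meson le_less_trans)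
  qed
  then show ?thesis
    by (rule convergentI)
qed


section \<open>The chronological radius\<close>

lemma matching_map_kernel: "matching_map *v v = 0 \<longleftrightarrow> v $ 2 + v $ 4 = 0"
  by (auto simp: matching_map_def vec_eq_iff matrix_vector_mult_def sum_4 vector_def)

text \<open>On the kernel the second components of the two blocks are opposite, so the entries 1/2
  and 1 combine to the eigenvalue 1/2. What remains is triangular: \<open>v $ 2\<close> evolves
  alone, feeds the third coordinate through t, and from there the first.\<close>

lemma transition_mat_mult_vec:
  assumes "e \<in> {0, 1}" "v $ 2 + v $ 4 = 0"
  shows "(transition_mat (level_mask a t) k e *v v) $ 1 = a k * (if e = 0 then v $ 1 else v $ 3)"
    "(transition_mat (level_mask a t) k e *v v) $ 2 = v $ 2 / 2"
    "(transition_mat (level_mask a t) k e *v v) $ 3 = (if e = 0 then t k * v $ 2 else - t k * v $ 2)"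
    "(transition_mat (level_mask a t) k e *v v) $ 4 = - v $ 2 / 2"
proof -
  have "v $ 4 = - v $ 2"
    using assms(2) by simp
  then show "(transition_mat (level_mask a t) k e *v v) $ 1 = a k * (if e = 0 then v $ 1 else v $ 3)"
    "(transition_mat (level_mask a t) k e *v v) $ 2 = v $ 2 / 2"
    "(transition_mat (level_mask a t) k e *v v) $ 3 = (if e = 0 then t k * v $ 2 else - t k * v $ 2)"
    "(transition_mat (level_mask a t) k e *v v) $ 4 = - v $ 2 / 2"
    using assms(1)
    by (auto simp: transition_mat_def matrix_vector_mult_def sum_4 block_idx_def block_pos_def
        level_mask_def)
qed

text \<open>The matrix product as an action on R^4, free of the basis U.\<close>

definition transition_orbit ::
  "masks \<Rightarrow> (nat \<Rightarrow> int) \<Rightarrow> nat list \<Rightarrow> real^4 \<Rightarrow> real^4" where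
  "transition_orbit A e = foldr (\<lambda>i v. transition_mat A i (e i) *v v)"

lemma transition_orbit_simps [simp]:
  "transition_orbit A e [] v = v"
  "transition_orbit A e (i # is) v = transition_mat A i (e i) *v transition_orbit A e is v"
  by (simp_all add: transition_orbit_def)

lemma transition_orbit_kernel:
  assumes "\<forall>i\<in>set is. e i \<in> {0, 1}" "v $ 2 + v $ 4 = 0"
  shows "transition_orbit (level_mask a t) e is v $ 2 +
    transition_orbit (level_mask a t) e is v $ 4 = 0"
  using assms(1)
proof (induction "is")
  case (Cons i "is")
  then show ?case
    by (simp add: transition_mat_mult_vec)
qed (simp add: assms(2))

lemma orthonormal_kernel_basis_transpose_mult:
  assumes "orthonormal_kernel_basis P U"
  shows "transpose U ** U = mat 1"
  using assms
  by (simp add: orthonormal_kernel_basis_def vec_eq_iff matrix_matrix_mult_def transpose_def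
      mat_def inner_vec_def column_def)

text \<open>U U^T is the orthogonal projection onto the span of the columns, which is the
  kernel.\<close>

lemma orthonormal_kernel_basis_project:
  assumes U: "orthonormal_kernel_basis P U" and v: "P *v v = 0"
  shows "U *v (transpose U *v v) = v"
proof -
  have "v \<in> span (columns U)"
    using assms by (simp add: orthonormal_kernel_basis_def)
  then show ?thesis
  proof (induction rule: span_induct)
    case base
    show ?case
      by (simp add: subspace_def matrix_vector_right_distrib matrix_vector_mult_scaleR
          del: transpose_matrix_vector)
  next
    case (step x)
    then obtain i where "x = U *v axis i 1"
      by (auto simp: columns_def matrix_vector_mult_basis)
    then have "transpose U *v x = axis i 1"
      using orthonormal_kernel_basis_transpose_mult[OF U]
      by (simp add: matrix_vector_mul_assoc)
    then show ?case
      using \<open>x = U *v axis i 1\<close> by simp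
  qed
qed

text \<open>Between consecutive factors stands U U^T, applied to a vector of the kernel because the
  kernel is invariant; there it is the identity and cancels.\<close>

lemma restricted_product_mult_vec:
  assumes U: "orthonormal_kernel_basis matching_map U" and e: "\<forall>i\<in>set is. e i \<in> {0, 1}"
  shows "foldr (**) (map (\<lambda>i. restricted_mat (level_mask a t) U i (e i)) is) (mat 1) *v x =
    transpose U *v transition_orbit (level_mask a t) e is (U *v x)"
  using e
proof (induction "is")
  case Nil
  then show ?case
    by (simp add: matrix_vector_mul_assoc orthonormal_kernel_basis_transpose_mult[OF U])
next
  case (Cons i "is")
  have "U *v x \<in> span (columns U)"
    by (rule matrix_vector_mult_in_columnspace)
  then have "(U *v x) $ 2 + (U *v x) $ 4 = 0"
    using U by (simp add: orthonormal_kernel_basis_def matching_map_kernel)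
  then have "matching_map *v transition_orbit (level_mask a t) e is (U *v x) = 0"
    using transition_orbit_kernel[of "is" e "U *v x" a t] Cons.prems
    by (simp add: matching_map_kernel)
  from orthonormal_kernel_basis_project[OF U this] show ?case
    using Cons by (simp add: restricted_mat_def flip: matrix_vector_mul_assoc)
qed

context contraction_seq
begin

text \<open>
  The factor \<open>1/2\<close> on the second coordinate is dominated by every \<open>a\<^sub>i\<close>, so the coupling through
  \<open>t\<close> costs only a constant factor.
\<close>

lemma transition_orbit_bound:
  assumes t: "t \<in> unit_seqs" and "\<forall>i\<in>set is. 1 \<le> i \<and> e i \<in> {0, 1}"
    and v: "v $ 2 + v $ 4 = 0" "\<And>i. \<bar>v $ i\<bar> \<le> 1"
  defines "q \<equiv> prod_list (map a is)" and "w \<equiv> transition_orbit (level_mask a t) e is v"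
  shows "\<bar>w $ 1\<bar> \<le> 2 * q \<and> \<bar>w $ 2\<bar> \<le> q \<and> \<bar>w $ 3\<bar> \<le> 2 * q \<and> \<bar>w $ 4\<bar> \<le> q"
  using assms(2) unfolding q_def w_def
proof (induction "is")
  case Nil
  then show ?case
    using v(2)[of 1] v(2)[of 2] v(2)[of 3] v(2)[of 4] by simp
next
  case (Cons i "is")
  define p where "p = prod_list (map a is)"
  define u where "u = transition_orbit (level_mask a t) e is v"
  have IH: "\<bar>u $ 1\<bar> \<le> 2 * p" "\<bar>u $ 2\<bar> \<le> p" "\<bar>u $ 3\<bar> \<le> 2 * p"
    using Cons by (auto simp: p_def u_def)
  have i: "1 \<le> i" "e i \<in> {0, 1}"
    using Cons.prems by auto
  have u: "u $ 2 + u $ 4 = 0"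
    unfolding u_def using Cons.prems v(1) by (intro transition_orbit_kernel) auto
  \<comment> \<open>This closes the induction: the halved coordinate obeys p / 2 \<le> a i * p, and
    the new third one, at most p, obeys p \<le> 2 * (a i * p). Hence the factors 2.\<close>
  have half: "1 / 2 * p \<le> a i * p"
    using a_gt_half[OF i(1)] IH(2) by (intro mult_right_mono) auto
  have "\<bar>t i * u $ 2\<bar> \<le> \<bar>u $ 2\<bar>"
    using t i(1) by (auto simp: unit_seqs_def abs_mult intro!: mult_left_le_one_le)
  moreover have "\<bar>a i * u $ 1\<bar> \<le> a i * (2 * p)" "\<bar>a i * u $ 3\<bar> \<le> a i * (2 * p)"
    using IH a_pos[OF i(1)] by (auto simp: abs_mult intro!: mult_left_mono)
  ultimately show ?case
    using half IH(2) i(2)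
    by (auto simp: transition_mat_mult_vec u u_def[symmetric] p_def[symmetric])
qed

text \<open>The columns of U are unit vectors, so its entries are at most 1. The orbit bounds 2, 1,
  2, 1 add up to 6, and nine entries give 54.\<close>

lemma restricted_product_norm_le:
  assumes t: "t \<in> unit_seqs" and U: "orthonormal_kernel_basis matching_map U"
    and "is": "\<forall>i\<in>set is. 1 \<le> i \<and> e i \<in> {0, 1}"
  shows "norm (foldr (**) (map (\<lambda>i. restricted_mat (level_mask a t) U i (e i)) is) (mat 1))
    \<le> 54 * prod_list (map a is)"
    (is "norm ?P \<le> 54 * ?q")
proof -
  have U_le_1: "\<bar>U $ r $ j\<bar> \<le> 1" for r j
  proof -
    have "column j U \<bullet> column j U = 1"
      using U by (auto simp: orthonormal_kernel_basis_def)
    then have "norm (column j U) = 1"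
      by (simp add: norm_eq_1)
    then show ?thesis
      using component_le_norm_cart[of "column j U" r] by (simp add: column_def)
  qed
  have entry: "\<bar>?P $ i $ j\<bar> \<le> 6 * ?q" for i j
  proof -
    define w where "w = transition_orbit (level_mask a t) e is (column j U)"
    have "column j U \<in> span (columns U)"
      by (auto simp: columns_def intro: span_base)
    then have "column j U $ 2 + column j U $ 4 = 0"
      using U by (simp add: orthonormal_kernel_basis_def matching_map_kernel)
    then have w: "\<bar>w $ 1\<bar> \<le> 2 * ?q" "\<bar>w $ 2\<bar> \<le> ?q" "\<bar>w $ 3\<bar> \<le> 2 * ?q" "\<bar>w $ 4\<bar> \<le> ?q"
      using transition_orbit_bound[OF t "is", of "column j U"] U_le_1
      by (auto simp: w_def column_def)
    have "?P $ i $ j = (?P *v axis j 1) $ i"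
      by (simp add: matrix_vector_mult_basis column_def)
    also have "\<dots> = (transpose U *v w) $ i"
      unfolding w_def using restricted_product_mult_vec[OF U, of "is" e a t "axis j 1"] "is"
      by (simp only: matrix_vector_mult_basis) simp
    also have "\<dots> = U $ 1 $ i * w $ 1 + U $ 2 $ i * w $ 2 + U $ 3 $ i * w $ 3 + U $ 4 $ i * w $ 4"
      by (simp add: matrix_vector_mult_def transpose_def sum_4)
    also have "\<bar>\<dots>\<bar> \<le> \<bar>w $ 1\<bar> + \<bar>w $ 2\<bar> + \<bar>w $ 3\<bar> + \<bar>w $ 4\<bar>"
    proof -
      have "\<bar>U $ r $ i * w $ r\<bar> \<le> \<bar>w $ r\<bar>" for r
        using U_le_1[of r i] by (simp add: abs_mult mult_left_le_one_le)
      from this[of 1] this[of 2] this[of 3] this[of 4] show ?thesis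
        by linarith
    qed
    finally show ?thesis
      using w by linarith
  qed
  have "norm ?P \<le> (\<Sum>i\<in>UNIV. norm (?P $ i))"
    unfolding norm_vec_def by (rule L2_set_le_sum) simp
  also have "\<dots> \<le> (\<Sum>i\<in>(UNIV::3 set). \<Sum>j\<in>(UNIV::3 set). \<bar>?P $ i $ j\<bar>)"
    by (intro sum_mono norm_le_l1_cart)
  also have "\<dots> \<le> (\<Sum>i\<in>(UNIV::3 set). \<Sum>j\<in>(UNIV::3 set). 6 * ?q)"
    by (intro sum_mono entry)
  finally show ?thesis
    by simp
qed

text \<open>The first unit vector lies in the kernel and is an eigenvector of every \<open>T\<^sub>0\<close>.\<close>

lemma restricted_product_norm_ge:
  assumes U: "orthonormal_kernel_basis matching_map U"
  obtains c where "c > 0"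
    "\<And>is e. \<forall>i\<in>set is. 1 \<le> i \<and> e i = 0 \<Longrightarrow> c * prod_list (map a is) \<le>
       norm (foldr (**) (map (\<lambda>i. restricted_mat (level_mask a t) U i (e i)) is) (mat 1))"
proof -
  define w where "w = transpose U *v axis 1 1"
  have "matching_map *v axis 1 1 = 0"
    by (simp add: matching_map_kernel axis_def)
  then have Uw: "U *v w = axis 1 1"
    unfolding w_def by (rule orthonormal_kernel_basis_project[OF U])
  then have "w \<noteq> 0"
    by (auto simp: axis_eq_0_iff)
  \<comment> \<open>Evaluation at w is linear in P, hence bounded; this controls a vector by
    \<open>norm P\<close>, which is not the operator norm.\<close>
  have "linear (\<lambda>P::real^3^3. P *v w)"
    by (rule linearI) (simp_all add: matrix_vector_mult_add_rdistrib scaleR_matrix_vector_assoc)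
  then obtain K where K: "K > 0" "\<And>P::real^3^3. norm (P *v w) \<le> norm P * K"
    using bounded_linear.pos_bounded linear_conv_bounded_linear by blast
  show ?thesis
  proof (rule that[of "norm w / K"])
    show "norm w / K > 0"
      using \<open>w \<noteq> 0\<close> K(1) by simp
  next
    fix "is" :: "nat list" and e :: "nat \<Rightarrow> int"
    assume "is": "\<forall>i\<in>set is. 1 \<le> i \<and> e i = 0"
    let ?P = "foldr (**) (map (\<lambda>i. restricted_mat (level_mask a t) U i (e i)) is) (mat 1)"
    let ?q = "prod_list (map a is)"
    have q: "0 \<le> ?q"
      using "is" a_pos by (intro prod_list_nonneg) (auto intro: less_imp_le)
    have "transition_orbit (level_mask a t) e is (axis 1 1) = ?q *\<^sub>R axis 1 1"
      using "is"
    proof (induction "is")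
      case (Cons i "is")
      then show ?case
        by (simp add: vec_eq_iff forall_4 transition_mat_mult_vec axis_def)
    qed simp
    moreover have "?P *v w = transpose U *v transition_orbit (level_mask a t) e is (axis 1 1)"
      using restricted_product_mult_vec[OF U, of "is" e a t w] "is" Uw by simp
    ultimately have "?P *v w = ?q *\<^sub>R w"
      unfolding w_def by (simp only: matrix_vector_mult_scaleR)
    then have "norm w * ?q \<le> norm ?P * K"
      using K(2)[of ?P] q by (simp add: mult.commute)
    then show "norm w / K * ?q \<le> norm ?P"
      using K(1) by (simp add: field_simps)
  qed
qed

section \<open>Block means of the logarithms and their limit\<close>

lemma log_inverse_a_bounds:
  assumes "1 \<le> i"
  shows "0 < log 2 (inverse (a i))" "log 2 (inverse (a i)) \<le> 1"
    "log 2 (inverse a_hi) \<le> log 2 (inverse (a i))"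
proof -
  have "a i < 1"
    using a_le[OF assms] hi_less_1 by linarith
  moreover have "inverse (a i) \<le> inverse (1 / 2)"
    using a_gt_half[OF assms] by (intro le_imp_inverse_le) auto
  ultimately show "0 < log 2 (inverse (a i))" "log 2 (inverse (a i)) \<le> 1"
    using a_pos[OF assms] by (auto simp: one_less_inverse log_le_iff)
  show "log 2 (inverse a_hi) \<le> log 2 (inverse (a i))"
    using a_pos[OF assms] a_hi_pos a_le[OF assms] by simp
qed

lemma lower_mean_bdd:
  "bdd_below ((\<lambda>r. (1 / real m) * (\<Sum>i\<in>{r..<r + m}. log 2 (inverse (a i)))) ` {1..})"
  using log_inverse_a_bounds(1)
  by (intro bdd_belowI[of _ 0]) (fastforce intro!: mult_nonneg_nonneg sum_nonneg intro: less_imp_le)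

text \<open>The product \<open>real m * lower_mean a m\<close> is the infimum of the block sums.
  This form also holds at m = 0, where both sides are 0.\<close>

lemma lower_mean_le:
  assumes "1 \<le> r"
  shows "real m * lower_mean a m \<le> (\<Sum>i\<in>{r..<r + m}. log 2 (inverse (a i)))"
proof (cases "m = 0")
  case False
  have "lower_mean a m \<le> (1 / real m) * (\<Sum>i\<in>{r..<r + m}. log 2 (inverse (a i)))"
    unfolding lower_mean_def using assms by (intro cINF_lower[OF lower_mean_bdd]) auto
  then show ?thesis
    using False by (simp add: field_simps)
qed simp

lemma lower_mean_ge:
  assumes "\<And>r. 1 \<le> r \<Longrightarrow> x \<le> (\<Sum>i\<in>{r..<r + m}. log 2 (inverse (a i)))"
  shows "x \<le> real m * lower_mean a m"
proof (cases "m = 0")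
  case True
  then show ?thesis
    using assms[of 1] by simp
next
  case False
  have "x / real m \<le> lower_mean a m"
    unfolding lower_mean_def
    by (rule cINF_greatest) (use assms in \<open>auto intro!: divide_right_mono\<close>)
  then show ?thesis
    using False by (simp add: field_simps)
qed

text \<open>A block of length m + n splits into blocks of lengths m and n, so the infima of block
  sums are superadditive. The linear bound has constant 1 because a_i > 1/2.\<close>

lemma convergent_lower_mean: "convergent (lower_mean a)"
proof -
  have "convergent (\<lambda>m. real m * lower_mean a m / real m)"
  proof (rule superadditive_convergent[of _ 1])
    fix m n :: nat
    show "real m * lower_mean a m + real n * lower_mean a n \<le> real (m + n) * lower_mean a (m + n)"
    proof (rule lower_mean_ge)
      fix r :: nat assume r: "1 \<le> r"
      have "(\<Sum>i\<in>{r..<r + (m + n)}. log 2 (inverse (a i))) =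
          (\<Sum>i\<in>{r..<r + m}. log 2 (inverse (a i))) + (\<Sum>i\<in>{r + m..<r + m + n}. log 2 (inverse (a i)))"
        by (simp add: sum.atLeastLessThan_concat add.assoc)
      then show "real m * lower_mean a m + real n * lower_mean a n
          \<le> (\<Sum>i\<in>{r..<r + (m + n)}. log 2 (inverse (a i)))"
        using lower_mean_le[of r m] lower_mean_le[of "r + m" n] r by simp
    qed
  next
    fix m :: nat
    show "0 \<le> real m * lower_mean a m"
      using log_inverse_a_bounds(1) by (intro lower_mean_ge sum_nonneg) (auto intro: less_imp_le)
    have "(\<Sum>i\<in>{1..<1 + m}. log 2 (inverse (a i))) \<le> (\<Sum>i\<in>{1..<1 + m}. 1)"
      using log_inverse_a_bounds(2) by (intro sum_mono) auto
    then show "real m * lower_mean a m \<le> 1 * real m"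
      using lower_mean_le[of 1 m] by simp
  qed
  moreover have "\<forall>\<^sub>F m in sequentially. real m * lower_mean a m / real m = lower_mean a m"
    using eventually_gt_at_top[of 0] by eventually_elim simp
  ultimately show ?thesis
    using convergent_cong by fast
qed

lemma lower_mean_tendsto: "lower_mean a \<longlonglongrightarrow> lambda_u a"
  using convergent_lower_mean unfolding lambda_u_def by (simp add: convergent_LIMSEQ_iff)

lemma powr_lambda_u_le: "2 powr (- lambda_u a) \<le> a_hi"
proof -
  have "\<forall>\<^sub>F m in sequentially. log 2 (inverse a_hi) \<le> lower_mean a m"
    using eventually_gt_at_top[of 0]
  proof eventually_elim
    case (elim m)
    have "real m * log 2 (inverse a_hi) \<le> real m * lower_mean a m"
    proof (rule lower_mean_ge)
      fix r :: nat assume "1 \<le> r"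
      then have "(\<Sum>i\<in>{r..<r + m}. log 2 (inverse a_hi)) \<le> (\<Sum>i\<in>{r..<r + m}. log 2 (inverse (a i)))"
        using log_inverse_a_bounds(3) by (intro sum_mono) auto
      then show "real m * log 2 (inverse a_hi) \<le> (\<Sum>i\<in>{r..<r + m}. log 2 (inverse (a i)))"
        by simp
    qed
    then show ?case
      using elim by simp
  qed
  then have "log 2 (inverse a_hi) \<le> lambda_u a"
    using lower_mean_tendsto by (intro tendsto_lowerbound[of "lower_mean a"]) auto
  then have "- lambda_u a \<le> log 2 a_hi"
    using a_hi_pos by (simp add: log_inverse)
  then show ?thesis
    using a_hi_pos by (simp add: le_log_iff)
qed

lemma prod_eq_powr:
  assumes "1 \<le> b"
  shows "prod_list (map a [b..<b + m]) = 2 powr (- (\<Sum>i\<in>{b..<b + m}. log 2 (inverse (a i))))"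
proof -
  have "prod_list (map a [b..<b + m]) = (\<Prod>i\<in>{b..<b + m}. a i)"
    by (simp flip: prod.distinct_set_conv_list)
  also have "\<dots> = (\<Prod>i\<in>{b..<b + m}. 2 powr (- log 2 (inverse (a i))))"
    using assms a_pos by (intro prod.cong) (auto simp: log_inverse)
  also have "\<dots> = 2 powr (\<Sum>i\<in>{b..<b + m}. - log 2 (inverse (a i)))"
    by (subst powr_sum) auto
  finally show ?thesis
    by (simp add: sum_negf)
qed

text \<open>The supremum over b of the products of a_i is 2 to the minus infimum of the block sums.
  \<chi>_m agrees with it up to factors c and C that do not depend on m or b, and their m-th roots
  tend to 1.\<close>

theorem chron_radius_level_mask:
  fixes t :: "nat \<Rightarrow> real"
  assumes t: "t \<in> unit_seqs" and "is_norm N" and U: "orthonormal_kernel_basis matching_map U"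
  shows "bdd_above (chron_max N (level_mask a t) U m ` {1..})"
    and "(\<lambda>m. root m (chron_sup N (level_mask a t) U m)) \<longlonglongrightarrow> 2 powr (- lambda_u a)"
proof -
  let ?A = "level_mask a t"
  obtain c\<^sub>N C\<^sub>N where N: "c\<^sub>N > 0" "C\<^sub>N > 0" "\<And>x. c\<^sub>N * norm x \<le> N x" "\<And>x. N x \<le> C\<^sub>N * norm x"
    using is_norm_equivalent[OF \<open>is_norm N\<close>] by blast
  obtain c\<^sub>U where c\<^sub>U: "c\<^sub>U > 0" "\<And>is e. \<forall>i\<in>set is. 1 \<le> i \<and> e i = 0 \<Longrightarrow> c\<^sub>U * prod_list (map a is) \<le>
       norm (foldr (**) (map (\<lambda>i. restricted_mat ?A U i (e i)) is) (mat 1))"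
    using restricted_product_norm_ge[OF U, of t] by blast
  define c where "c = c\<^sub>N * c\<^sub>U"
  define C where "C = C\<^sub>N * 54"
  have pos: "c > 0" "C > 0"
    using N c\<^sub>U by (auto simp: c_def C_def)
  let ?q = "\<lambda>b m. prod_list (map a [b..<b + m])"
  define \<mu> where "\<mu> m = real m * lower_mean a m" for m
  have q_le: "?q b m \<le> 2 powr (- \<mu> m)" if "1 \<le> b" for b m
    using lower_mean_le[OF that, of m] by (simp add: prod_eq_powr[OF that] \<mu>_def)
  have max_le: "chron_max N ?A U m b \<le> C * ?q b m" if "1 \<le> b" for b m
    unfolding chron_max_def
  proof (subst Max_le_iff)
    show "finite ((\<lambda>e. N (foldr (**) (map (\<lambda>i. restricted_mat ?A U i (e i)) [b..<b + m]) (mat 1)))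
          ` ({b..<b + m} \<rightarrow>\<^sub>E {0, 1}))"
      by (intro finite_imageI finite_PiE) auto
    show "\<forall>x\<in>(\<lambda>e. N (foldr (**) (map (\<lambda>i. restricted_mat ?A U i (e i)) [b..<b + m]) (mat 1)))
          ` ({b..<b + m} \<rightarrow>\<^sub>E {0, 1}). x \<le> C * ?q b m"
    proof safe
      fix e :: "nat \<Rightarrow> int" assume e: "e \<in> {b..<b + m} \<rightarrow>\<^sub>E {0, 1}"
      let ?P = "foldr (**) (map (\<lambda>i. restricted_mat ?A U i (e i)) [b..<b + m]) (mat 1)"
      have "\<forall>i\<in>set [b..<b + m]. 1 \<le> i \<and> e i \<in> {0, 1}"
        using that e by (auto simp: PiE_def Pi_def)
      then have "norm ?P \<le> 54 * ?q b m"
        by (rule restricted_product_norm_le[OF t U])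
      then have "C\<^sub>N * norm ?P \<le> C\<^sub>N * (54 * ?q b m)"
        using N(2) by (intro mult_left_mono) auto
      then show "N ?P \<le> C * ?q b m"
        using N(4)[of ?P] by (simp add: C_def mult.assoc)
    qed
  qed (auto simp: PiE_eq_empty_iff)
  have max_ge: "c * ?q b m \<le> chron_max N ?A U m b" if "1 \<le> b" for b m
  proof -
    \<comment> \<open>All digits 0 realise the lower bound; \<open>restrict\<close> places e among
      the extensional functions over which the maximum is taken.\<close>
    define e :: "nat \<Rightarrow> int" where "e = restrict (\<lambda>_. 0) {b..<b + m}"
    let ?P = "foldr (**) (map (\<lambda>i. restricted_mat ?A U i (e i)) [b..<b + m]) (mat 1)"
    have "c\<^sub>U * ?q b m \<le> norm ?P"
      using that by (intro c\<^sub>U(2)) (auto simp: e_def)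
    then have "c\<^sub>N * (c\<^sub>U * ?q b m) \<le> c\<^sub>N * norm ?P"
      using N(1) by (intro mult_left_mono) auto
    then have "c * ?q b m \<le> N ?P"
      using N(3)[of ?P] by (simp add: c_def mult.assoc)
    also have "\<dots> \<le> chron_max N ?A U m b"
      unfolding chron_max_def
      by (intro Max_ge finite_imageI finite_PiE imageI) (auto simp: e_def)
    finally show ?thesis .
  qed
  have max_le': "chron_max N ?A U m b \<le> C * 2 powr (- \<mu> m)" if "1 \<le> b" for b m
    using max_le[OF that, of m] mult_left_mono[OF q_le[OF that, of m], of C] pos by linarith
  show bdd: "bdd_above (chron_max N ?A U m ` {1..})" for m
    using max_le' by (intro bdd_aboveI[of _ "C * 2 powr (- \<mu> m)"]) auto
  have sup_le: "chron_sup N ?A U m \<le> C * 2 powr (- \<mu> m)" for m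
    unfolding chron_sup_def using max_le' by (intro cSUP_least) auto
  have sup_ge: "c * 2 powr (- \<mu> m) \<le> chron_sup N ?A U m" for m
  proof -
    let ?\<chi> = "chron_sup N ?A U m"
    have q: "c * ?q b m \<le> ?\<chi>" if "1 \<le> b" for b
      using max_ge[OF that, of m] cSUP_upper[OF _ bdd, of b m] that by (auto simp: chron_sup_def)
    have "0 < c * ?q 1 m"
      using pos prod_eq_powr[of 1 m] by simp
    then have \<chi>_pos: "0 < ?\<chi>"
      using q[of 1] by simp
    \<comment> \<open>Every start r bounds the same supremum from below. In logarithms this is one
      lower bound for all block sums, hence for their infimum.\<close>
    have "- log 2 (?\<chi> / c) \<le> \<mu> m"
      unfolding \<mu>_def
    proof (rule lower_mean_ge)
      fix r :: nat assume r: "1 \<le> r"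
      have "2 powr (- (\<Sum>i\<in>{r..<r + m}. log 2 (inverse (a i)))) \<le> ?\<chi> / c"
        using q[OF r] pos unfolding prod_eq_powr[OF r] by (simp add: pos_le_divide_eq mult.commute)
      then show "- log 2 (?\<chi> / c) \<le> (\<Sum>i\<in>{r..<r + m}. log 2 (inverse (a i)))"
        using \<chi>_pos pos by (simp add: powr_le_iff)
    qed
    then have "2 powr (- \<mu> m) \<le> ?\<chi> / c"
      using \<chi>_pos pos by (simp add: powr_le_iff)
    then show ?thesis
      using pos by (simp add: field_simps)
  qed
  have root_eq: "root m (d * 2 powr (- \<mu> m)) = root m d * 2 powr (- lower_mean a m)"
    if "m > 0" for d m
  proof -
    have "2 powr (- \<mu> m) = (2 powr (- lower_mean a m)) ^ m"
      by (simp add: \<mu>_def powr_power mult.commute)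
    then show ?thesis
      using that by (simp add: real_root_mult real_root_power_cancel)
  qed
  have lim: "(\<lambda>m. root m d * 2 powr (- lower_mean a m)) \<longlonglongrightarrow> 1 * 2 powr (- lambda_u a)"
    if "d > 0" for d
    by (intro tendsto_intros LIMSEQ_root_const lower_mean_tendsto that) auto
  show "(\<lambda>m. root m (chron_sup N ?A U m)) \<longlonglongrightarrow> 2 powr (- lambda_u a)"
  proof (rule tendsto_sandwich)
    show "\<forall>\<^sub>F m in sequentially. root m c * 2 powr (- lower_mean a m) \<le> root m (chron_sup N ?A U m)"
      using eventually_gt_at_top[of 0]
      by eventually_elim (simp add: sup_ge flip: root_eq)
    show "\<forall>\<^sub>F m in sequentially. root m (chron_sup N ?A U m) \<le> root m C * 2 powr (- lower_mean a m)"
      using eventually_gt_at_top[of 0]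
      by eventually_elim (simp add: sup_le flip: root_eq)
  qed (use lim[OF pos(1)] lim[OF pos(2)] in simp_all)
qed

end


section \<open>Covering numbers\<close>

text \<open>Rounding up adds less than 1, which costs at most ln (1 + 1 / y) \<le> 1 / y. For y
  \<le> 1 the ceiling is 1 and both terms of d vanish.\<close>

lemma log_ceiling_excess:
  fixes y :: real
  assumes "y > 0"
  defines "d \<equiv> log 2 (real (nat \<lceil>y\<rceil>)) - max (log 2 y) 0"
  shows "0 \<le> d" "d \<le> (if 1 < y then 1 / (y * ln 2) else 0)"
proof -
  define n where "n = real (nat \<lceil>y\<rceil>)"
  have "nat \<lceil>y\<rceil> \<ge> 1"
    using assms(1) by linarith
  then have n: "y \<le> n" "n < y + 1" "1 \<le> n"
    using assms(1) unfolding n_def by linarith+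
  show "0 \<le> d"
    using n assms(1) unfolding d_def n_def[symmetric] by (simp add: max_def)
  show "d \<le> (if 1 < y then 1 / (y * ln 2) else 0)"
  proof (cases "1 < y")
    case True
    have "log 2 n - log 2 y = ln (n / y) / ln 2"
      using n assms(1) by (simp add: log_def ln_div diff_divide_distrib)
    also have "\<dots> \<le> (1 / y) / ln 2"
    proof (rule divide_right_mono)
      have "ln (n / y) \<le> n / y - 1"
        using n assms(1) by (intro ln_le_minus_one) simp
      also have "\<dots> = (n - y) / y"
        using assms(1) by (simp add: diff_divide_distrib)
      also have "\<dots> \<le> 1 / y"
        using n assms(1) by (intro divide_right_mono) auto
      finally show "ln (n / y) \<le> 1 / y" .
    qed simp
    finally show ?thesis
      using True assms(1) unfolding d_def n_def[symmetric] by (simp add: max_def)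
  next
    case False
    then have "nat \<lceil>y\<rceil> = 1"
      using assms(1) by (simp add: ceiling_eq_iff nat_eq_iff)
    then show ?thesis
      using False by (simp add: d_def)
  qed
qed

context contraction_seq
begin

text \<open>For positive \<epsilon> the least K with a_hi ^ K \<le> \<epsilon>. The target is
  \<epsilon> rather than 2 \<epsilon> because later coordinates are replaced by 0 instead of a
  midpoint.\<close>

definition cutoff :: "real \<Rightarrow> nat" where
  "cutoff \<epsilon> = nat \<lceil>log 2 (inverse \<epsilon>) / log 2 (inverse a_hi)\<rceil>"

definition cells :: "real \<Rightarrow> nat \<Rightarrow> nat" where
  "cells \<epsilon> k = nat \<lceil>weight a k / (2 * \<epsilon>)\<rceil>"

definition grid :: "real \<Rightarrow> (nat \<Rightarrow> nat) set" where
  "grid \<epsilon> = (\<Pi>\<^sub>E k\<in>{1..cutoff \<epsilon>}. {..<cells \<epsilon> k})"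

definition midpoint_seq :: "real \<Rightarrow> (nat \<Rightarrow> nat) \<Rightarrow> nat \<Rightarrow> real" where
  "midpoint_seq \<epsilon> i k =
     (if k \<in> {1..cutoff \<epsilon>} then (2 * real (i k) + 1) / (2 * real (cells \<epsilon> k)) else 0)"

lemma finite_grid: "finite (grid \<epsilon>)"
  unfolding grid_def by (intro finite_PiE) auto

lemma card_grid: "card (grid \<epsilon>) = (\<Prod>k=1..cutoff \<epsilon>. cells \<epsilon> k)"
  unfolding grid_def by (simp add: card_PiE)

lemma log_inverse_a_hi_pos: "0 < log 2 (inverse a_hi)"
  using a_hi_pos hi_less_1 by (simp add: one_less_inverse)

lemma weight_le_eps:
  assumes "0 < \<epsilon>" "cutoff \<epsilon> < k"
  shows "weight a k \<le> \<epsilon>"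
proof -
  let ?K = "cutoff \<epsilon>"
  have "log 2 (inverse \<epsilon>) / log 2 (inverse a_hi) \<le> real ?K"
    unfolding cutoff_def by linarith
  then have "log 2 (inverse \<epsilon>) \<le> real ?K * log 2 (inverse a_hi)"
    using log_inverse_a_hi_pos by (simp add: divide_le_eq)
  then have "real ?K * log 2 a_hi \<le> log 2 \<epsilon>"
    using assms(1) a_hi_pos by (simp add: log_inverse)
  then have "log 2 (a_hi ^ ?K) \<le> log 2 \<epsilon>"
    using a_hi_pos by (simp add: log_nat_power)
  then have "a_hi ^ ?K \<le> \<epsilon>"
    using assms(1) a_hi_pos by simp
  then show ?thesis
    using weight_le_power[of ?K] weight_antimono[of "Suc ?K" k] assms(2) by linarith
qed

text \<open>The two sides of the ceiling: the second bound makes cells of length at most 2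
  \<epsilon>, for the cover; the strict third one makes the spacing exceed 2 \<epsilon> with one
  cell less, for the packing.\<close>

lemma cells_bounds:
  assumes "0 < \<epsilon>"
  shows "1 \<le> cells \<epsilon> k" "weight a k \<le> 2 * \<epsilon> * real (cells \<epsilon> k)"
    "2 * \<epsilon> * (real (cells \<epsilon> k) - 1) < weight a k"
proof -
  have pos: "0 < weight a k / (2 * \<epsilon>)"
    using weight_pos[of k] assms by simp
  then show "1 \<le> cells \<epsilon> k"
    unfolding cells_def by linarith
  have "weight a k / (2 * \<epsilon>) \<le> real (cells \<epsilon> k)" "real (cells \<epsilon> k) - 1 < weight a k / (2 * \<epsilon>)"
    using pos unfolding cells_def by linarith+
  then show "weight a k \<le> 2 * \<epsilon> * real (cells \<epsilon> k)"
    "2 * \<epsilon> * (real (cells \<epsilon> k) - 1) < weight a k"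
    using assms by (simp_all add: field_simps)
qed

lemma grid_covers:
  assumes \<epsilon>: "0 < \<epsilon>" and "f \<in> phi_class a"
  shows "\<exists>i\<in>grid \<epsilon>. unif_norm (\<lambda>x. f x - phi a (midpoint_seq \<epsilon> i) x) \<le> ereal \<epsilon>"
proof -
  obtain t where t: "t \<in> unit_seqs" and f: "f = phi a t"
    using assms(2) by (auto simp: phi_class_def)
  let ?n = "cells \<epsilon>"
  \<comment> \<open>The index of the cell containing \<open>t k\<close>; the minimum puts
    \<open>t k = 1\<close> into the last cell.\<close>
  define i where "i = restrict (\<lambda>k. min (?n k - 1) (nat \<lfloor>t k * real (?n k)\<rfloor>)) {1..cutoff \<epsilon>}"
  have "i \<in> grid \<epsilon>"
    using cells_bounds(1)[OF \<epsilon>] by (auto simp: grid_def i_def min_less_iff_disj Suc_le_eq)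
  moreover have "weight a k * \<bar>t k - midpoint_seq \<epsilon> i k\<bar> \<le> \<epsilon>" if k: "1 \<le> k" for k
  proof -
    have tk: "0 \<le> t k" "t k \<le> 1"
      using t k by (auto simp: unit_seqs_def)
    show ?thesis
    proof (cases "k \<le> cutoff \<epsilon>")
      case True
      define n where "n = real (?n k)"
      have n: "1 \<le> n" "weight a k \<le> 2 * \<epsilon> * n"
        using cells_bounds(1,2)[OF \<epsilon>, of k] by (auto simp: n_def)
      have tn: "0 \<le> t k * n" "t k * n \<le> n"
        using tk n by (auto simp: mult_left_le_one_le)
      have "real (i k) = min (n - 1) (real (nat \<lfloor>t k * n\<rfloor>))"
        using k True cells_bounds(1)[OF \<epsilon>, of k] by (simp add: i_def n_def of_nat_diff)
      then have "real (i k) \<le> t k * n" "t k * n \<le> real (i k) + 1"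
        using tn by linarith+
      then have "\<bar>2 * (t k * n) - (2 * real (i k) + 1)\<bar> \<le> 1"
        by linarith
      moreover have "t k - midpoint_seq \<epsilon> i k = (2 * (t k * n) - (2 * real (i k) + 1)) / (2 * n)"
        using k True n(1) by (simp add: midpoint_seq_def n_def[symmetric] field_simps)
      ultimately have "\<bar>t k - midpoint_seq \<epsilon> i k\<bar> \<le> 1 / (2 * n)"
        using n(1) by (simp add: divide_right_mono)
      then have "weight a k * \<bar>t k - midpoint_seq \<epsilon> i k\<bar> \<le> (2 * \<epsilon> * n) * (1 / (2 * n))"
        using n \<epsilon> by (intro mult_mono) auto
      then show ?thesis
        using n(1) by simp
    next
      case False
      then have "weight a k * t k \<le> \<epsilon> * 1"
        using weight_le_eps[OF \<epsilon>, of k] tk \<epsilon> by (intro mult_mono) auto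
      then show ?thesis
        using False tk by (simp add: midpoint_seq_def)
    qed
  qed
  then have "unif_norm (\<lambda>x. phi a t x - phi a (midpoint_seq \<epsilon> i) x) \<le> ereal \<epsilon>"
    by (intro unif_norm_phi_diff_le) simp
  ultimately show ?thesis
    unfolding f by blast
qed

text \<open>
  A ball of radius \<open>\<epsilon>\<close> contains at most one \<open>\<phi>\<^sub>p\<close> whose coordinates are endpoints of the
  subdivisions into \<open>cells \<epsilon> k - 1\<close> parts. If \<open>cells \<epsilon> k = 1\<close>, the quotient below is \<open>0 / 0 = 0\<close>.
\<close>

lemma card_grid_le_card_cover:
  assumes \<epsilon>: "0 < \<epsilon>" and F: "ball_cover \<epsilon> (phi_class a) F"
  shows "card (grid \<epsilon>) \<le> card F"
proof -
  define p where "p i k = (if k \<in> {1..cutoff \<epsilon>} then real (i k) / (real (cells \<epsilon> k) - 1) else 0)"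
    for i :: "nat \<Rightarrow> nat" and k
  have p: "phi a (p i) \<in> phi_class a" if "i \<in> grid \<epsilon>" for i
  proof -
    have "0 \<le> p i k \<and> p i k \<le> 1" if "1 \<le> k" for k
    proof (cases "k \<le> cutoff \<epsilon>")
      case True
      then have "real (i k) \<le> real (cells \<epsilon> k) - 1"
        using \<open>i \<in> grid \<epsilon>\<close> that by (force simp: grid_def PiE_def Pi_def)
      then show ?thesis
        by (auto simp: p_def divide_le_eq_1)
    qed (simp add: p_def)
    then show ?thesis
      by (auto simp: phi_class_def unit_seqs_def)
  qed
  then have "\<forall>i\<in>grid \<epsilon>. \<exists>c\<in>F. unif_norm (\<lambda>x. phi a (p i) x - c x) \<le> ereal \<epsilon>"
    using F by (auto simp: ball_cover_def)
  then obtain g where g: "\<And>i. i \<in> grid \<epsilon> \<Longrightarrow> g i \<in> F"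
    "\<And>i. i \<in> grid \<epsilon> \<Longrightarrow> unif_norm (\<lambda>x. phi a (p i) x - g i x) \<le> ereal \<epsilon>"
    by metis
  have "inj_on g (grid \<epsilon>)"
  proof (rule inj_onI)
    fix i j assume ij: "i \<in> grid \<epsilon>" "j \<in> grid \<epsilon>" "g i = g j"
    show "i = j"
    proof (rule ccontr)
      assume "i \<noteq> j"
      then obtain k where k: "k \<in> {1..cutoff \<epsilon>}" "i k \<noteq> j k"
        using ij(1,2) unfolding grid_def by (metis PiE_ext)
      define n where "n = real (cells \<epsilon> k) - 1"
      have lt: "i k < cells \<epsilon> k" "j k < cells \<epsilon> k"
        using ij k by (auto simp: grid_def PiE_def Pi_def)
      then have n: "n > 0"
        using k(2) unfolding n_def by linarith
      \<comment> \<open>Only the value of the centre at the peak of bump k enters, so nothing about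
        the shape of the centre is used.\<close>
      have near: "\<bar>weight a k * p i' k - g i' (3 / 2 ^ k)\<bar> \<le> \<epsilon>" if "i' \<in> grid \<epsilon>" for i'
        using g(2)[OF that] k(1) unfolding unif_norm_le_iff
        by (metis infnorm_real phi_peak atLeastAtMost_iff)
      have "\<bar>weight a k * p i k - weight a k * p j k\<bar> \<le> 2 * \<epsilon>"
        using near[OF ij(1)] near[OF ij(2)] unfolding ij(3) by linarith
      moreover have "weight a k * p i k - weight a k * p j k =
          weight a k / n * (real (i k) - real (j k))"
        using k(1) n by (simp add: p_def n_def[symmetric] field_simps)
      moreover have "weight a k / n * 1 \<le> \<bar>weight a k / n * (real (i k) - real (j k))\<bar>"
        unfolding abs_mult using weight_pos[of k] n k(2) by (intro mult_mono) auto
      ultimately have "weight a k \<le> 2 * \<epsilon> * n"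
        using n by (simp add: divide_le_eq)
      then show False
        using cells_bounds(3)[OF \<epsilon>, of k] by (simp add: n_def)
    qed
  qed
  then show ?thesis
    using g(1) F by (intro card_inj_on_le[of g]) (auto simp: ball_cover_def)
qed

lemma ball_cover_midpoints:
  assumes "0 < \<epsilon>"
  shows "ball_cover \<epsilon> (phi_class a) ((\<lambda>i. phi a (midpoint_seq \<epsilon> i)) ` grid \<epsilon>)"
proof -
  have "bounded (range (phi a (midpoint_seq \<epsilon> i)))" for i
    by (rule bounded_range_phi_finite[of "cutoff \<epsilon>"]) (simp add: midpoint_seq_def)
  then show ?thesis
    using grid_covers[OF assms] by (auto simp: ball_cover_def finite_grid)
qed

text \<open>The midpoints form a cover themselves, so the packing bound applies to them and shows
  that no two coincide.\<close>

lemma card_midpoints: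
  assumes "0 < \<epsilon>"
  shows "card ((\<lambda>i. phi a (midpoint_seq \<epsilon> i)) ` grid \<epsilon>) = card (grid \<epsilon>)"
  using card_grid_le_card_cover[OF assms ball_cover_midpoints[OF assms]]
    card_image_le[OF finite_grid]
  by (metis le_antisym)

lemma covering_number_phi_class:
  assumes "0 < \<epsilon>"
  shows "covering_number \<epsilon> (phi_class a) = (\<Prod>k=1..cutoff \<epsilon>. cells \<epsilon> k)"
  unfolding covering_number_def card_grid[symmetric]
proof (rule Least_equality)
  show "\<exists>F. ball_cover \<epsilon> (phi_class a) F \<and> card F = card (grid \<epsilon>)"
    using ball_cover_midpoints[OF assms] card_midpoints[OF assms] by blast
qed (use card_grid_le_card_cover[OF assms] in blast)

text \<open>A geometric series summed backwards from its largest term, the last. The step closes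
  because a_hi / (1 - a_hi) + 1 = 1 / (1 - a_hi).\<close>

lemma sum_inverse_weight_le:
  "(\<Sum>j\<le>J. 1 / weight a (Suc j)) \<le> 1 / ((1 - a_hi) * weight a (Suc J))"
proof (induction J)
  case 0
  then show ?case
    using a_hi_pos hi_less_1 by (simp add: field_simps)
next
  case (Suc J)
  let ?w = "weight a (Suc (Suc J))"
  have w: "0 < ?w" "?w = weight a (Suc J) * a (Suc J)"
    using weight_pos[of "Suc (Suc J)"] by (auto simp: weight_Suc)
  have "1 / ((1 - a_hi) * weight a (Suc J)) = a (Suc J) / ((1 - a_hi) * ?w)"
    using w a_pos[of "Suc J"] by simp
  also have "\<dots> \<le> a_hi / ((1 - a_hi) * ?w)"
    using w a_le[of "Suc J"] hi_less_1 by (intro divide_right_mono) auto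
  finally have "(\<Sum>j\<le>Suc J. 1 / weight a (Suc j)) \<le> a_hi / ((1 - a_hi) * ?w) + 1 / ?w"
    using Suc.IH by simp
  also have "\<dots> = 1 / ((1 - a_hi) * ?w)"
    using w(1) hi_less_1 by (simp add: field_simps)
  finally show ?case .
qed

lemma logsum_ge: "log 2 (inverse a_hi) * real j \<le> logsum a j"
proof -
  have "(\<Sum>i=1..j. log 2 (inverse a_hi)) \<le> logsum a j"
    unfolding logsum_def using log_inverse_a_bounds(3) by (intro sum_mono) auto
  then show ?thesis
    by (simp add: mult.commute)
qed

definition ramp_sum :: "real \<Rightarrow> real" where
  "ramp_sum Y = (\<Sum>j. max (Y - logsum a j) 0)"

text \<open>The ratio y j has logarithm X - 1 - L_j, so replacing each ceiling by its argument, cut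
  off at 1, turns the logarithm of the covering number into the ramp sum.\<close>

lemma entropy_phi_class:
  assumes \<epsilon>: "0 < \<epsilon>"
  defines "X \<equiv> log 2 (inverse \<epsilon>)"
  shows "ramp_sum (X - 1) \<le> entropy \<epsilon> (phi_class a)"
    and "entropy \<epsilon> (phi_class a) \<le> ramp_sum (X - 1) + 1 / ((1 - a_hi) * ln 2)"
proof -
  define y where "y j = weight a (Suc j) / (2 * \<epsilon>)" for j
  have y_pos: "0 < y j" for j
    using weight_pos \<epsilon> by (simp add: y_def)
  have log_y: "log 2 (y j) = X - 1 - logsum a j" for j
    using weight_pos[of "Suc j"] \<epsilon>
    by (simp add: y_def X_def logsum_eq log_divide_pos log_mult_pos log_inverse)
  let ?K = "cutoff \<epsilon>"
  have "entropy \<epsilon> (phi_class a) = (\<Sum>k=1..?K. log 2 (real (cells \<epsilon> k)))"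
    unfolding entropy_def covering_number_phi_class[OF \<epsilon>] of_nat_prod
    using cells_bounds(1)[OF \<epsilon>] by (simp add: log_def ln_prod Suc_le_eq sum_divide_distrib)
  also have "\<dots> = (\<Sum>j<?K. log 2 (real (nat \<lceil>y j\<rceil>)))"
    by (rule sum.reindex_bij_witness[of _ Suc "\<lambda>k. k - 1"]) (auto simp: cells_def y_def)
  finally have entropy: "entropy \<epsilon> (phi_class a) = (\<Sum>j<?K. log 2 (real (nat \<lceil>y j\<rceil>)))" .
  have ramp: "ramp_sum (X - 1) = (\<Sum>j<?K. max (log 2 (y j)) 0)"
    unfolding ramp_sum_def log_y[symmetric]
  proof (rule suminf_finite)
    fix j assume "j \<notin> {..<?K}"
    then have "y j \<le> 1"
      using weight_le_eps[OF \<epsilon>, of "Suc j"] \<epsilon> by (simp add: y_def)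
    then show "max (log 2 (y j)) 0 = 0"
      using y_pos[of j] by simp
  qed simp
  define d where "d j = log 2 (real (nat \<lceil>y j\<rceil>)) - max (log 2 (y j)) 0" for j
  have sum_d: "entropy \<epsilon> (phi_class a) - ramp_sum (X - 1) = (\<Sum>j<?K. d j)"
    by (simp add: entropy ramp d_def sum_subtractf)
  have d: "0 \<le> d j" "d j \<le> (if 1 < y j then 1 / (y j * ln 2) else 0)" for j
    unfolding d_def using log_ceiling_excess[OF y_pos] by auto
  have "0 \<le> (\<Sum>j<?K. d j)"
    using d by (intro sum_nonneg) auto
  then show "ramp_sum (X - 1) \<le> entropy \<epsilon> (phi_class a)"
    using sum_d by linarith
  have "(\<Sum>j<?K. d j) \<le> (\<Sum>j<?K. if 1 < y j then 1 / (y j * ln 2) else 0)"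
    using d by (intro sum_mono) auto
  also have "\<dots> = (\<Sum>j\<in>{j\<in>{..<?K}. 1 < y j}. 1 / (y j * ln 2))"
    by (rule sum.inter_filter[symmetric]) simp
  also have "\<dots> \<le> 1 / ((1 - a_hi) * ln 2)"
  proof (cases "{j\<in>{..<?K}. 1 < y j} = {}")
    case True
    then show ?thesis
      using hi_less_1 by (simp only: sum.empty) simp
  next
    case False
    \<comment> \<open>The last level with y > 1. There 2 \<epsilon> /
      \<open>weight a (Suc J)\<close> = 1 / y J < 1, which removes \<epsilon> from the geometric
      bound.\<close>
    define J where "J = Max {j\<in>{..<?K}. 1 < y j}"
    have fin: "finite {j\<in>{..<?K}. 1 < y j}"
      by simp
    have J: "1 < y J"
      using Max_in[OF fin False] by (simp add: J_def)
    have "(\<Sum>j\<in>{j\<in>{..<?K}. 1 < y j}. 1 / (y j * ln 2)) \<le> (\<Sum>j\<le>J. 1 / (y j * ln 2))"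
      using Max_ge[OF fin] y_pos by (intro sum_mono2) (auto simp: J_def less_imp_le)
    also have "\<dots> = 2 * \<epsilon> / ln 2 * (\<Sum>j\<le>J. 1 / weight a (Suc j))"
      by (simp add: sum_distrib_left sum_divide_distrib y_def mult.commute)
    also have "\<dots> \<le> 2 * \<epsilon> / ln 2 * (1 / ((1 - a_hi) * weight a (Suc J)))"
      using \<epsilon> by (intro mult_left_mono sum_inverse_weight_le) auto
    also have "\<dots> = 1 / y J * (1 / ((1 - a_hi) * ln 2))"
      by (simp add: y_def)
    also have "\<dots> \<le> 1 * (1 / ((1 - a_hi) * ln 2))"
      using J hi_less_1 by (intro mult_right_mono) auto
    finally show ?thesis
      by simp
  qed
  finally show "entropy \<epsilon> (phi_class a) \<le> ramp_sum (X - 1) + 1 / ((1 - a_hi) * ln 2)"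
    using sum_d by linarith
qed

end


section \<open>Asymptotics of the entropy\<close>

text \<open>The arithmetic sum is exactly Z^2 / (2 \<mu>) + Z / 2 + \<mu> \<theta> (1 - \<theta>) /
  2, where 1 - \<theta> is the fractional part of Z / \<mu>; both bounds are read off.\<close>

lemma sum_linear_ramp:
  fixes \<mu> Z :: real
  assumes "0 < \<mu>" "0 \<le> Z"
  defines "S \<equiv> (\<Sum>j. max (Z - \<mu> * real j) 0)"
  shows "Z\<^sup>2 / (2 * \<mu>) \<le> S" "S \<le> Z\<^sup>2 / (2 * \<mu>) + Z / 2 + \<mu> / 2"
proof -
  define z where "z = Z / \<mu>"
  have Z: "Z = \<mu> * z" "0 \<le> z"
    using assms by (auto simp: z_def)
  define M where "M = Suc (nat \<lfloor>z\<rfloor>)"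
  define \<theta> where "\<theta> = real M - z"
  have \<theta>: "0 \<le> \<theta>" "\<theta> \<le> 1"
    using Z(2) unfolding \<theta>_def M_def by linarith+
  have ramp: "max (Z - \<mu> * real j) 0 = (if j < M then Z - \<mu> * real j else 0)" for j
  proof (cases "j < M")
    case True
    then have "real j \<le> z"
      using Z(2) unfolding M_def by linarith
    then show ?thesis
      using True assms(1) by (simp add: Z(1))
  next
    case False
    then have "z \<le> real j"
      unfolding M_def by linarith
    then show ?thesis
      using False assms(1) by (simp add: Z(1))
  qed
  have "S = (\<Sum>j<M. max (Z - \<mu> * real j) 0)"
    unfolding S_def by (rule suminf_finite) (auto simp: ramp)
  also have "\<dots> = (\<Sum>j<M. Z - \<mu> * real j)"
    by (intro sum.cong) (auto simp: ramp)
  also have "\<dots> = real M * Z - \<mu> * (real M * (real M - 1) / 2)"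
  proof (induction M)
    case (Suc M)
    then show ?case
      by (simp add: field_simps)
  qed simp
  also have "\<dots> = Z\<^sup>2 / (2 * \<mu>) + Z / 2 + \<mu> * (\<theta> * (1 - \<theta>)) / 2"
  proof -
    have "real M = z + \<theta>"
      by (simp add: \<theta>_def)
    then show ?thesis
      using assms(1) by (simp add: Z(1) field_simps power2_eq_square)
  qed
  finally have S: "S = Z\<^sup>2 / (2 * \<mu>) + Z / 2 + \<mu> * (\<theta> * (1 - \<theta>)) / 2" .
  have "0 \<le> \<theta> * (1 - \<theta>)" "\<theta> * (1 - \<theta>) \<le> 1"
    using \<theta> by (auto intro: mult_le_one)
  then have "0 \<le> \<mu> * (\<theta> * (1 - \<theta>))" "\<mu> * (\<theta> * (1 - \<theta>)) \<le> \<mu>"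
    using assms(1) by (auto intro: mult_left_le)
  then show "Z\<^sup>2 / (2 * \<mu>) \<le> S" "S \<le> Z\<^sup>2 / (2 * \<mu>) + Z / 2 + \<mu> / 2"
    using S assms(2) by linarith+
qed

lemma summable_ramp:
  fixes f :: "nat \<Rightarrow> real"
  assumes "0 < \<mu>" "\<And>j. f j \<le> Z - \<mu> * real j"
  shows "summable (\<lambda>j. max (f j) 0)"
proof (rule summable_finite)
  show "finite {..nat \<lceil>Z / \<mu>\<rceil>}"
    by simp
  fix j assume "j \<notin> {..nat \<lceil>Z / \<mu>\<rceil>}"
  then have "Z / \<mu> \<le> real j"
    by (simp add: not_le) linarith
  then have "Z \<le> \<mu> * real j"
    using assms(1) by (simp add: divide_le_eq mult.commute)
  then show "max (f j) 0 = 0"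
    using assms(2)[of j] by simp
qed

text \<open>Turns an eventual comparison of L_n with a linear function into one valid for all n up
  to an additive constant, as the ramp bounds require.\<close>

lemma eventually_nonpos_imp_bounded:
  fixes f :: "nat \<Rightarrow> real"
  assumes "\<forall>\<^sub>F n in sequentially. f n \<le> 0"
  obtains c where "0 \<le> c" "\<And>n. f n \<le> c"
proof -
  obtain n\<^sub>0 where n\<^sub>0: "\<And>n. n \<ge> n\<^sub>0 \<Longrightarrow> f n \<le> 0"
    using assms by (auto simp: eventually_sequentially)
  have nonneg: "0 \<le> (\<Sum>i<n\<^sub>0. \<bar>f i\<bar>)"
    by (intro sum_nonneg) simp
  have "f n \<le> (\<Sum>i<n\<^sub>0. \<bar>f i\<bar>)" for n
  proof (cases "n < n\<^sub>0")
    case True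
    then have "\<bar>f n\<bar> \<le> (\<Sum>i<n\<^sub>0. \<bar>f i\<bar>)"
      by (intro member_le_sum) auto
    then show ?thesis
      by linarith
  next
    case False
    then show ?thesis
      using n\<^sub>0[of n] nonneg by linarith
  qed
  with nonneg show ?thesis
    using that by blast
qed

lemma filterlim_log_inverse_at_right_0:
  "filterlim (\<lambda>\<epsilon>::real. log 2 (inverse \<epsilon>)) at_top (at_right 0)"
  by real_asymp

context contraction_seq
begin

lemma summable_ramp_logsum: "summable (\<lambda>j. max (Y - logsum a j) 0)"
  using logsum_ge by (intro summable_ramp[OF log_inverse_a_hi_pos, of _ Y]) (simp add: algebra_simps)

lemma ramp_sum_le:
  assumes "0 < \<mu>" "\<And>j. \<mu> * real j - c \<le> logsum a j" "0 \<le> Y + c"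
  shows "ramp_sum Y \<le> (Y + c)\<^sup>2 / (2 * \<mu>) + (Y + c) / 2 + \<mu> / 2"
proof -
  have le: "Y - logsum a j \<le> (Y + c) - \<mu> * real j" for j
    using assms(2)[of j] by linarith
  have "ramp_sum Y \<le> (\<Sum>j. max ((Y + c) - \<mu> * real j) 0)"
    unfolding ramp_sum_def
    by (intro suminf_le summable_ramp_logsum summable_ramp[OF assms(1)])
      (use le in \<open>auto simp: max.coboundedI1\<close>)
  also have "\<dots> \<le> (Y + c)\<^sup>2 / (2 * \<mu>) + (Y + c) / 2 + \<mu> / 2"
    by (rule sum_linear_ramp(2)[OF assms(1,3)])
  finally show ?thesis .
qed

lemma ramp_sum_ge:
  assumes "0 < \<mu>" "\<And>j. logsum a j \<le> \<mu> * real j + c" "0 \<le> Y - c"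
  shows "(Y - c)\<^sup>2 / (2 * \<mu>) \<le> ramp_sum Y"
proof -
  have le: "(Y - c) - \<mu> * real j \<le> Y - logsum a j" for j
    using assms(2)[of j] by linarith
  have "(Y - c)\<^sup>2 / (2 * \<mu>) \<le> (\<Sum>j. max ((Y - c) - \<mu> * real j) 0)"
    by (rule sum_linear_ramp(1)[OF assms(1,3)])
  also have "\<dots> \<le> ramp_sum Y"
    unfolding ramp_sum_def
    by (intro suminf_le summable_ramp_logsum summable_ramp[OF assms(1)])
      (use le in \<open>auto simp: max.coboundedI1\<close>)
  finally show ?thesis .
qed

lemma entropy_le_quadratic:
  assumes "0 < \<mu>" "0 \<le> c" "\<And>j. \<mu> * real j - c \<le> logsum a j"
  obtains D where "\<And>\<epsilon>. 0 < \<epsilon> \<Longrightarrow> 1 \<le> log 2 (inverse \<epsilon>) \<Longrightarrow>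
    entropy \<epsilon> (phi_class a) \<le> (log 2 (inverse \<epsilon>))\<^sup>2 / (2 * \<mu>) + D * log 2 (inverse \<epsilon>)"
proof -
  define B where "B = c / 2 + \<mu> / 2 + 1 / ((1 - a_hi) * ln 2) + c\<^sup>2 / (2 * \<mu>)"
  have B: "0 \<le> B"
    using assms(1,2) hi_less_1 by (simp add: B_def)
  have "entropy \<epsilon> (phi_class a) \<le> X\<^sup>2 / (2 * \<mu>) + (c / \<mu> + 1 / 2 + B) * X"
    if \<epsilon>: "0 < \<epsilon>" and X: "X = log 2 (inverse \<epsilon>)" "1 \<le> X" for \<epsilon> X
  proof -
    \<comment> \<open>The constant is weakened to c + 1 so that it absorbs the shift in X - 1 and
      leaves X + c.\<close>
    have "ramp_sum (X - 1) \<le> (X - 1 + (c + 1))\<^sup>2 / (2 * \<mu>) + (X - 1 + (c + 1)) / 2 + \<mu> / 2"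
      by (rule ramp_sum_le)
        (use assms(2) assms(3) X in \<open>auto simp: assms(1) intro: order_trans[OF _ assms(3)]\<close>)
    also have "\<dots> = X\<^sup>2 / (2 * \<mu>) + (c / \<mu> + 1 / 2) * X + (c / 2 + \<mu> / 2 + c\<^sup>2 / (2 * \<mu>))"
      using assms(1) by (simp add: field_simps power2_eq_square)
    finally have "entropy \<epsilon> (phi_class a) \<le> X\<^sup>2 / (2 * \<mu>) + (c / \<mu> + 1 / 2) * X + B"
      using entropy_phi_class(2)[OF \<epsilon>] by (simp add: X(1)[symmetric] B_def)
    also have "B \<le> B * X"
      using B X(2) by (simp add: mult_le_cancel_left1)
    finally show ?thesis
      by (simp add: distrib_right)
  qed
  then show ?thesis
    using that by blast
qed

lemma entropy_ge_quadratic: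
  assumes "0 < \<mu>" "0 \<le> c" "\<And>j. logsum a j \<le> \<mu> * real j + c"
    and "0 < \<epsilon>" "1 + c \<le> log 2 (inverse \<epsilon>)"
  shows "(log 2 (inverse \<epsilon>))\<^sup>2 / (2 * \<mu>) - (1 + c) / \<mu> * log 2 (inverse \<epsilon>) \<le> entropy \<epsilon> (phi_class a)"
proof -
  define X where "X = log 2 (inverse \<epsilon>)"
  have "X\<^sup>2 / (2 * \<mu>) - (1 + c) / \<mu> * X = (X - 1 - c)\<^sup>2 / (2 * \<mu>) - (1 + c)\<^sup>2 / (2 * \<mu>)"
    using assms(1) by (simp add: field_simps power2_eq_square)
  also have "\<dots> \<le> (X - 1 - c)\<^sup>2 / (2 * \<mu>)"
    using assms(1) by simp
  also have "\<dots> \<le> ramp_sum (X - 1)"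
    using assms by (intro ramp_sum_ge) (auto simp: X_def)
  also have "\<dots> \<le> entropy \<epsilon> (phi_class a)"
    unfolding X_def by (rule entropy_phi_class(1)[OF assms(4)])
  finally show ?thesis
    by (simp add: X_def)
qed

lemma logsum_mean_limit_pos:
  assumes "(\<lambda>n. logsum a n / real n) \<longlonglongrightarrow> l"
  shows "0 < l"
proof -
  have "log 2 (inverse a_hi) \<le> l"
  proof (rule tendsto_lowerbound[OF assms])
    show "\<forall>\<^sub>F n in sequentially. log 2 (inverse a_hi) \<le> logsum a n / real n"
      using eventually_gt_at_top[of 0]
      by eventually_elim (use logsum_ge in \<open>simp add: le_divide_eq\<close>)
  qed simp
  then show ?thesis
    using log_inverse_a_hi_pos by linarith
qed

text \<open>Convergence of L_n / n confines L_n between lines of slopes slightly below and above l.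
  The slopes cost \<eta> / 2 in the quadratic coefficient; the linear terms use up the other
  half.\<close>

lemma entropy_smallo:
  assumes lim: "(\<lambda>n. logsum a n / real n) \<longlonglongrightarrow> l"
  shows "(\<lambda>\<epsilon>. entropy \<epsilon> (phi_class a) - (log 2 (inverse \<epsilon>))\<^sup>2 / (2 * l))
    \<in> o[at_right 0](\<lambda>\<epsilon>. (log 2 (inverse \<epsilon>))\<^sup>2)"
proof (rule landau_o.smallI)
  fix \<eta> :: real assume \<eta>: "0 < \<eta>"
  have l: "0 < l"
    by (rule logsum_mean_limit_pos[OF lim])
  \<comment> \<open>\<open>\<mu>\<^sub>1\<close> solves 1 / (2 \<mu>) = 1 / (2 l) + \<eta> / 2. The
    mirror choice l / (1 - \<eta> l) need not be positive, so \<open>\<mu>\<^sub>2\<close> is chosen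
    to satisfy just the inequality.\<close>
  define \<mu>\<^sub>1 where "\<mu>\<^sub>1 = l / (1 + \<eta> * l)"
  define \<mu>\<^sub>2 where "\<mu>\<^sub>2 = l * (1 + \<eta> * l)"
  have pos: "0 < 1 + \<eta> * l"
    using \<eta> l by (simp add: add_pos_pos)
  have \<mu>_pos: "0 < \<mu>\<^sub>1" "0 < \<mu>\<^sub>2"
    using pos l by (auto simp: \<mu>\<^sub>1_def \<mu>\<^sub>2_def)
  have \<mu>\<^sub>1: "\<mu>\<^sub>1 < l" "1 / (2 * \<mu>\<^sub>1) = 1 / (2 * l) + \<eta> / 2"
    using pos l \<eta> by (auto simp: \<mu>\<^sub>1_def field_simps)
  have \<mu>\<^sub>2: "l < \<mu>\<^sub>2" "1 / (2 * l) - \<eta> / 2 \<le> 1 / (2 * \<mu>\<^sub>2)"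
  proof -
    show "l < \<mu>\<^sub>2"
      using l \<eta> by (simp add: \<mu>\<^sub>2_def algebra_simps)
    have "(1 - \<eta> * l) * (1 + \<eta> * l) \<le> 1"
      using \<eta> l by (simp add: algebra_simps)
    then have "1 - \<eta> * l \<le> 1 / (1 + \<eta> * l)"
      using pos by (simp add: le_divide_eq)
    then have "(1 - \<eta> * l) / (2 * l) \<le> 1 / (1 + \<eta> * l) / (2 * l)"
      using l by (intro divide_right_mono) auto
    then show "1 / (2 * l) - \<eta> / 2 \<le> 1 / (2 * \<mu>\<^sub>2)"
      using l by (simp add: \<mu>\<^sub>2_def diff_divide_distrib mult.commute mult.left_commute)
  qed
  have "\<forall>\<^sub>F n in sequentially. \<mu>\<^sub>1 * real n - logsum a n \<le> 0"
    using order_tendstoD(1)[OF lim \<mu>\<^sub>1(1)] eventually_gt_at_top[of 0]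
    by eventually_elim (simp add: less_divide_eq)
  then obtain c\<^sub>1 where c\<^sub>1: "0 \<le> c\<^sub>1" "\<And>n. \<mu>\<^sub>1 * real n - logsum a n \<le> c\<^sub>1"
    by (rule eventually_nonpos_imp_bounded) blast
  have "\<forall>\<^sub>F n in sequentially. logsum a n - \<mu>\<^sub>2 * real n \<le> 0"
    using order_tendstoD(2)[OF lim \<mu>\<^sub>2(1)] eventually_gt_at_top[of 0]
    by eventually_elim (simp add: divide_less_eq)
  then obtain c\<^sub>2 where c\<^sub>2: "0 \<le> c\<^sub>2" "\<And>n. logsum a n - \<mu>\<^sub>2 * real n \<le> c\<^sub>2"
    by (rule eventually_nonpos_imp_bounded) blast
  have "\<mu>\<^sub>1 * real j - c\<^sub>1 \<le> logsum a j" for j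
    using c\<^sub>1(2)[of j] by linarith
  then obtain D where D: "\<And>\<epsilon>. 0 < \<epsilon> \<Longrightarrow> 1 \<le> log 2 (inverse \<epsilon>) \<Longrightarrow>
    entropy \<epsilon> (phi_class a) \<le> (log 2 (inverse \<epsilon>))\<^sup>2 / (2 * \<mu>\<^sub>1) + D * log 2 (inverse \<epsilon>)"
    using entropy_le_quadratic[OF \<mu>_pos(1) c\<^sub>1(1)] by blast
  have lower: "logsum a j \<le> \<mu>\<^sub>2 * real j + c\<^sub>2" for j
    using c\<^sub>2(2)[of j] by linarith
  define b where "b = (1 + c\<^sub>2) / \<mu>\<^sub>2"
  \<comment> \<open>From this threshold on, both linear terms D X and b X are at most \<eta> / 2
    times X^2.\<close>
  let ?X\<^sub>0 = "max (1 + c\<^sub>2) (max (2 * D / \<eta>) (2 * b / \<eta>))"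
  have "\<forall>\<^sub>F \<epsilon> in at_right 0. ?X\<^sub>0 \<le> log 2 (inverse \<epsilon>)"
    using filterlim_log_inverse_at_right_0 unfolding filterlim_at_top by blast
  then show "\<forall>\<^sub>F \<epsilon> in at_right 0. norm (entropy \<epsilon> (phi_class a) - (log 2 (inverse \<epsilon>))\<^sup>2 / (2 * l))
      \<le> \<eta> * norm ((log 2 (inverse \<epsilon>))\<^sup>2)"
    using eventually_at_right_less[of 0]
  proof eventually_elim
    case (elim \<epsilon>)
    define X where "X = log 2 (inverse \<epsilon>)"
    have X: "1 + c\<^sub>2 \<le> X" "D \<le> \<eta> / 2 * X" "b \<le> \<eta> / 2 * X"
      using elim(1) \<eta> by (auto simp: X_def divide_le_eq mult.commute)
    have X_nonneg: "1 \<le> X"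
      using X(1) c\<^sub>2(1) by linarith
    have "D * X \<le> \<eta> / 2 * X\<^sup>2" "b * X \<le> \<eta> / 2 * X\<^sup>2"
      using mult_right_mono[OF X(2), of X] mult_right_mono[OF X(3), of X] X_nonneg
      by (auto simp: power2_eq_square)
    moreover have "X\<^sup>2 * (1 / (2 * l) - \<eta> / 2) \<le> X\<^sup>2 * (1 / (2 * \<mu>\<^sub>2))"
      using \<mu>\<^sub>2(2) by (intro mult_left_mono) auto
    moreover have "X\<^sup>2 * (1 / (2 * \<mu>\<^sub>1)) = X\<^sup>2 * (1 / (2 * l) + \<eta> / 2)"
      by (simp only: \<mu>\<^sub>1(2))
    moreover have "entropy \<epsilon> (phi_class a) \<le> X\<^sup>2 / (2 * \<mu>\<^sub>1) + D * X"
      using D[of \<epsilon>] elim(2) X_nonneg by (simp add: X_def)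
    moreover have "X\<^sup>2 / (2 * \<mu>\<^sub>2) - b * X \<le> entropy \<epsilon> (phi_class a)"
      using entropy_ge_quadratic[OF \<mu>_pos(2) c\<^sub>2(1) lower elim(2)] X(1) by (simp add: X_def b_def)
    ultimately show ?case
      unfolding X_def[symmetric] by (simp add: abs_le_iff algebra_simps)
  qed
qed

text \<open>Bounded deviation permits the slope l itself in both directions, so the quadratic terms
  agree and only linear ones remain.\<close>

lemma entropy_bigo:
  assumes lim: "(\<lambda>n. logsum a n / real n) \<longlonglongrightarrow> l"
    and bdd: "bdd_above (range (\<lambda>n. \<bar>logsum a n - l * real n\<bar>))"
  shows "(\<lambda>\<epsilon>. entropy \<epsilon> (phi_class a) - (log 2 (inverse \<epsilon>))\<^sup>2 / (2 * l))
    \<in> O[at_right 0](\<lambda>\<epsilon>. log 2 (inverse \<epsilon>))"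
proof -
  have l: "0 < l"
    by (rule logsum_mean_limit_pos[OF lim])
  obtain c where c: "\<And>n. \<bar>logsum a n - l * real n\<bar> \<le> c"
    using bdd by (auto simp: bdd_above_def)
  have c_nonneg: "0 \<le> c"
    using c[of 0] by linarith
  have L: "l * real j - c \<le> logsum a j" "logsum a j \<le> l * real j + c" for j
    using c[of j] by linarith+
  obtain D where D: "\<And>\<epsilon>. 0 < \<epsilon> \<Longrightarrow> 1 \<le> log 2 (inverse \<epsilon>) \<Longrightarrow>
    entropy \<epsilon> (phi_class a) \<le> (log 2 (inverse \<epsilon>))\<^sup>2 / (2 * l) + D * log 2 (inverse \<epsilon>)"
    using entropy_le_quadratic[OF l c_nonneg L(1)] by blast
  let ?K = "max D ((1 + c) / l)"
  show ?thesis
  proof (rule bigoI[of _ ?K])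
    have "\<forall>\<^sub>F \<epsilon> in at_right 0. 1 + c \<le> log 2 (inverse \<epsilon>)"
      using filterlim_log_inverse_at_right_0 unfolding filterlim_at_top by blast
    then show "\<forall>\<^sub>F \<epsilon> in at_right 0. norm (entropy \<epsilon> (phi_class a) - (log 2 (inverse \<epsilon>))\<^sup>2 / (2 * l))
        \<le> ?K * norm (log 2 (inverse \<epsilon>))"
      using eventually_at_right_less[of 0]
    proof eventually_elim
      case (elim \<epsilon>)
      define X where "X = log 2 (inverse \<epsilon>)"
      have X: "1 \<le> X"
        using elim(1) c_nonneg by (simp add: X_def)
      have "D * X \<le> ?K * X" "(1 + c) / l * X \<le> ?K * X"
        using X by (intro mult_right_mono max.cobounded1 max.cobounded2; simp)+
      moreover have "entropy \<epsilon> (phi_class a) \<le> X\<^sup>2 / (2 * l) + D * X"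
        using D[of \<epsilon>] elim(2) X by (simp add: X_def)
      moreover have "X\<^sup>2 / (2 * l) - (1 + c) / l * X \<le> entropy \<epsilon> (phi_class a)"
        unfolding X_def by (rule entropy_ge_quadratic[OF l c_nonneg L(2) elim(2) elim(1)])
      ultimately have "\<bar>entropy \<epsilon> (phi_class a) - X\<^sup>2 / (2 * l)\<bar> \<le> ?K * X"
        by linarith
      then show ?case
        using X by (simp add: X_def)
    qed
  qed
qed

end


section \<open>Fixed-length codes\<close>

lemma card_bool_lists: "card {\<sigma> :: bool list. length \<sigma> = B} = 2 ^ B"
  using card_lists_length_eq[of "UNIV :: bool set" B] by (simp add: card_UNIV_bool)

lemma finite_bool_lists: "finite {\<sigma> :: bool list. length \<sigma> = B}"
  using finite_lists_length_eq[of "UNIV :: bool set" B] by simp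

text \<open>The images of all B-bit words under the decoder are the centres of a cover.\<close>

lemma covering_number_le_code:
  assumes code: "fixed_length_code C B E R" and dist: "distortion C E R \<le> ereal \<epsilon>"
  shows "covering_number \<epsilon> C \<le> 2 ^ B"
proof -
  let ?S = "{\<sigma> :: bool list. length \<sigma> = B}"
  have "ball_cover \<epsilon> C (R ` ?S)"
    unfolding ball_cover_def
  proof (intro conjI ballI)
    fix f assume f: "f \<in> C"
    then have "unif_norm (\<lambda>x. f x - R (E f) x) \<le> ereal \<epsilon>"
      using dist by (auto simp: distortion_def SUP_le_iff)
    moreover have "R (E f) \<in> R ` ?S"
      using code f by (auto simp: fixed_length_code_def)
    ultimately show "\<exists>c\<in>R ` ?S. unif_norm (\<lambda>x. f x - c x) \<le> ereal \<epsilon>"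
      by blast
  qed (use code finite_bool_lists in \<open>auto simp: fixed_length_code_def\<close>)
  then have "covering_number \<epsilon> C \<le> card (R ` ?S)"
    unfolding covering_number_def by (intro Least_le) blast
  also have "\<dots> \<le> 2 ^ B"
    using card_image_le[OF finite_bool_lists] by (metis card_bool_lists)
  finally show ?thesis .
qed

lemma ball_cover_code:
  assumes F: "ball_cover \<epsilon> C F" "F \<noteq> {}" "card F \<le> 2 ^ B"
  obtains E R where "fixed_length_code C B E R" "distortion C E R \<le> ereal \<epsilon>" "range R \<subseteq> F"
proof -
  let ?S = "{\<sigma> :: bool list. length \<sigma> = B}"
  have fin: "finite F"
    using F(1) by (simp add: ball_cover_def)
  obtain g where g: "inj_on g F" "g ` F \<subseteq> ?S"
    using card_le_inj[OF fin finite_bool_lists[of B]] F(3) by (auto simp: card_bool_lists)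
  obtain c\<^sub>0 where c\<^sub>0: "c\<^sub>0 \<in> F"
    using F(2) by blast
  \<comment> \<open>Words outside the image of g decode to a fixed centre, so that every
    reconstruction lies in F.\<close>
  define R where "R \<sigma> = (if \<sigma> \<in> g ` F then the_inv_into F g \<sigma> else c\<^sub>0)" for \<sigma>
  have R_F: "R \<sigma> \<in> F" for \<sigma>
    using g(1) c\<^sub>0 by (auto simp: R_def the_inv_into_f_f)
  have "\<forall>f\<in>C. \<exists>c\<in>F. unif_norm (\<lambda>x. f x - c x) \<le> ereal \<epsilon>"
    using F(1) by (simp add: ball_cover_def)
  then obtain n where n: "\<And>f. f \<in> C \<Longrightarrow> n f \<in> F"
    "\<And>f. f \<in> C \<Longrightarrow> unif_norm (\<lambda>x. f x - n f x) \<le> ereal \<epsilon>"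
    by metis
  have R_g: "R (g (n f)) = n f" if "f \<in> C" for f
    using n(1)[OF that] g(1) by (simp add: R_def the_inv_into_f_f)
  show ?thesis
  proof (rule that[of "g \<circ> n" R])
    show "fixed_length_code C B (g \<circ> n) R"
      using n(1) g(2) R_F F(1) by (auto simp: fixed_length_code_def ball_cover_def)
    show "distortion C (g \<circ> n) R \<le> ereal \<epsilon>"
      unfolding distortion_def using n(2) R_g by (intro SUP_least) simp
    show "range R \<subseteq> F"
      using R_F by blast
  qed
qed

text \<open>A cover of size n is indexed by b bits exactly if the ceiling of log2 n is at most b.
  Keeping \<open>range R\<close> inside F lets properties of the chosen centres pass to all
  reconstructions.\<close>

lemma optimal_bits_minimal_cover:
  assumes F: "ball_cover \<epsilon> C F" "F \<noteq> {}" "card F = covering_number \<epsilon> C"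
  shows "int (optimal_bits \<epsilon> C) = \<lceil>entropy \<epsilon> C\<rceil>"
    and "\<exists>E R. fixed_length_code C (optimal_bits \<epsilon> C) E R \<and> distortion C E R \<le> ereal \<epsilon> \<and> range R \<subseteq> F"
proof -
  let ?n = "covering_number \<epsilon> C"
  have "finite F"
    using F(1) by (simp add: ball_cover_def)
  then have n: "1 \<le> ?n"
    using F(2,3) by (metis One_nat_def Suc_leI card_gt_0_iff)
  define B where "B = nat \<lceil>entropy \<epsilon> C\<rceil>"
  have B: "?n \<le> 2 ^ b \<longleftrightarrow> B \<le> b" for b
  proof -
    have "?n \<le> 2 ^ b \<longleftrightarrow> real ?n \<le> 2 ^ b"
      by (metis of_nat_le_iff of_nat_numeral of_nat_power)
    also have "\<dots> \<longleftrightarrow> entropy \<epsilon> C \<le> real b"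
      unfolding entropy_def using n by (subst log_le_iff) (auto simp: powr_realpow)
    also have "\<dots> \<longleftrightarrow> B \<le> b"
      unfolding B_def by linarith
    finally show ?thesis .
  qed
  obtain E R where ER: "fixed_length_code C B E R" "distortion C E R \<le> ereal \<epsilon>" "range R \<subseteq> F"
    using ball_cover_code[OF F(1,2), of B] F(3) B by auto
  have opt: "optimal_bits \<epsilon> C = B"
    unfolding optimal_bits_def
  proof (rule Least_equality)
    show "\<exists>E R. fixed_length_code C B E R \<and> distortion C E R \<le> ereal \<epsilon>"
      using ER by blast
  qed (use covering_number_le_code B in blast)
  have "0 \<le> entropy \<epsilon> C"
    unfolding entropy_def using n by simp
  then show "int (optimal_bits \<epsilon> C) = \<lceil>entropy \<epsilon> C\<rceil>"
    unfolding opt B_def by simp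
  show "\<exists>E R. fixed_length_code C (optimal_bits \<epsilon> C) E R \<and> distortion C E R \<le> ereal \<epsilon> \<and> range R \<subseteq> F"
    unfolding opt using ER by blast
qed


section \<open>ReLU networks for sums of dilated hats\<close>

text \<open>
  After the hidden layer of level \<open>k\<close> the five neurons hold \<open>x\<^sub>+\<close>, the three ReLU pieces of
  \<open>hat (2\<^sup>k x - 2)\<close>, and the partial sum over the levels below \<open>k\<close>, which passes the activation
  unchanged because it is nonnegative.
\<close>

fun hat_sum_tail :: "(nat \<Rightarrow> real) \<Rightarrow> nat \<Rightarrow> nat \<Rightarrow> layer list" where
  "hat_sum_tail c k 0 = [([[0, c k, -2 * c k, c k, 1]], [0])]"
| "hat_sum_tail c k (Suc n) =
     ([[1, 0, 0, 0, 0], [2 ^ Suc k, 0, 0, 0, 0], [2 ^ Suc k, 0, 0, 0, 0], [2 ^ Suc k, 0, 0, 0, 0],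
       [0, c k, -2 * c k, c k, 1]], [0, -2, -3, -4, 0]) # hat_sum_tail c (Suc k) n"

definition hat_sum_net :: "(nat \<Rightarrow> real) \<Rightarrow> nat \<Rightarrow> layer list" where
  "hat_sum_net c K = ([[1], [2], [2], [2], [0]], [0, -2, -3, -4, 0]) # hat_sum_tail c 1 (K - 1)"

lemma net_apply_Cons:
  "ls \<noteq> [] \<Longrightarrow> net_apply (l # ls) x = net_apply ls (map (\<lambda>u. max u 0) (layer_apply l x))"
  by (cases ls) auto

lemma hat_sum_tail_not_Nil: "hat_sum_tail c k n \<noteq> []"
  by (cases n) auto

text \<open>Generalised over level and accumulator for the induction on the remaining layers.
  Nonnegative coefficients keep s nonnegative, and p is nonnegative, so ReLU carries both
  unchanged.\<close>

lemma net_apply_hat_sum_tail: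
  assumes "0 \<le> p" "0 \<le> s" "\<And>i. 0 \<le> c i"
  shows "net_apply (hat_sum_tail c k n)
      [p, max (2 ^ k * p - 2) 0, max (2 ^ k * p - 3) 0, max (2 ^ k * p - 4) 0, s] =
    [s + (\<Sum>i=k..k + n. c i * hat (2 ^ i * p - 2))]"
  using assms(2)
proof (induction n arbitrary: k s)
  case 0
  then show ?case
    by (simp add: layer_apply_def hat_eq_relu algebra_simps)
next
  case (Suc n)
  define s' where "s' = s + c k * hat (2 ^ k * p - 2)"
  have s': "0 \<le> s'"
    using Suc.prems assms(3)[of k] hat_nonneg by (simp add: s'_def)
  have acc: "c k * max (2 ^ k * p - 2) 0 +
      (- 2 * c k * max (2 ^ k * p - 3) 0 + (c k * max (2 ^ k * p - 4) 0 + s)) = s'"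
    by (simp add: s'_def hat_eq_relu algebra_simps)
  have "{k..k + Suc n} = insert k {Suc k..Suc k + n}"
    by auto
  then have "s + (\<Sum>i=k..k + Suc n. c i * hat (2 ^ i * p - 2)) =
      s' + (\<Sum>i=Suc k..Suc k + n. c i * hat (2 ^ i * p - 2))"
    by (simp add: s'_def)
  then show ?case
    using Suc.IH[OF s', of "Suc k"] acc assms(1) s'
    by (simp add: net_apply_Cons[OF hat_sum_tail_not_Nil] layer_apply_def max_absorb1 algebra_simps)
qed

lemma net_dims_hat_sum_tail: "net_dims 5 (hat_sum_tail c k n) 1"
  by (induction n arbitrary: k) (auto simp: eval_nat_numeral)

lemma net_computes_hat_sum_net:
  assumes "1 \<le> K" "\<And>i. 0 \<le> c i"
  shows "net_computes (hat_sum_net c K) (\<lambda>x. \<Sum>k=1..K. c k * hat (2 ^ k * x - 2))"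
proof -
  have "net_apply (hat_sum_net c K) [x] = [\<Sum>k=1..K. c k * hat (2 ^ k * x - 2)]" for x
  proof -
    \<comment> \<open>The first neuron can only carry the positive part of x. Nothing is lost, since
      every bump vanishes for negative x and at 0.\<close>
    define p where "p = max x 0"
    have hat_p: "hat (2 ^ k * p - 2) = hat (2 ^ k * x - 2)" for k
    proof (cases "0 \<le> x")
      case False
      then have "2 ^ k * x \<le> 0"
        by (simp add: mult_le_0_iff)
      then show ?thesis
        using False hat_eq_0[of "2 ^ k * x - 2"] hat_eq_0[of "-2"] by (simp add: p_def)
    qed (simp add: p_def)
    have "net_apply (hat_sum_net c K) [x] = net_apply (hat_sum_tail c 1 (K - 1))
        [p, max (2 ^ 1 * p - 2) 0, max (2 ^ 1 * p - 3) 0, max (2 ^ 1 * p - 4) 0, 0]"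
      unfolding hat_sum_net_def net_apply_Cons[OF hat_sum_tail_not_Nil]
      by (auto simp: layer_apply_def p_def max_def intro!: arg_cong[of _ _ "net_apply _"])
    also have "\<dots> = [\<Sum>k=1..K. c k * hat (2 ^ k * p - 2)]"
      using net_apply_hat_sum_tail[of p 0 c 1 "K - 1"] assms by (simp add: p_def)
    also have "\<dots> = [\<Sum>k=1..K. c k * hat (2 ^ k * x - 2)]"
      by (simp add: hat_p)
    finally show ?thesis .
  qed
  moreover have "net_dims 1 (hat_sum_net c K) 1"
    using net_dims_hat_sum_tail by (simp add: hat_sum_net_def eval_nat_numeral)
  ultimately show ?thesis
    by (simp add: net_computes_def hat_sum_net_def)
qed

lemma length_hat_sum_tail: "length (hat_sum_tail c k n) = Suc n"
  by (induction n arbitrary: k) auto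

lemma net_depth_hat_sum_net: "1 \<le> K \<Longrightarrow> net_depth (hat_sum_net c K) = K"
  by (simp add: net_depth_def hat_sum_net_def length_hat_sum_tail hat_sum_tail_not_Nil)

lemma net_width_hat_sum_net: "net_width (hat_sum_net c K) \<le> 5"
proof -
  have "length (snd l) \<le> 5" if "l \<in> set (hat_sum_tail c k n)" for l k n
    using that by (induction n arbitrary: k) auto
  then have "length (snd l) \<le> 5" if "l \<in> set (butlast (hat_sum_net c K))" for l
    using in_set_butlastD[OF that] by (fastforce simp: hat_sum_net_def)
  then show ?thesis
    unfolding net_width_def by (subst Max_le_iff) auto
qed

text \<open>Each of the K - 1 square layers has 25 weights and 5 biases; the first layer with 10
  parameters and the output layer with 6 fit into another 30.\<close>

lemma net_params_hat_sum_net: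
  assumes "1 \<le> K"
  shows "net_params (hat_sum_net c K) \<le> 30 * K"
proof -
  have "net_params (hat_sum_tail c k n) = 30 * n + 6" for k n
    by (induction n arbitrary: k) (auto simp: net_params_def)
  then show ?thesis
    using assms by (simp add: hat_sum_net_def net_params_def)
qed

lemma net_rational_hat_sum_net:
  assumes "\<And>i. c i \<in> \<rat>"
  shows "net_rational (hat_sum_net c K)"
proof -
  have "net_rational (hat_sum_tail c k n)" for k n
    by (induction n arbitrary: k) (auto simp: net_rational_def assms)
  then show ?thesis
    by (auto simp: hat_sum_net_def net_rational_def)
qed


section \<open>Optimal ReLU codes\<close>

context contraction_seq
begin

text \<open>Since X > 1, the 1 lost in the ceiling is absorbed into a multiple of X.\<close>

lemma cutoff_bounds:
  assumes "1 < log 2 (inverse \<epsilon>)"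
  shows "1 \<le> cutoff \<epsilon>" "real (cutoff \<epsilon>) \<le> (1 / log 2 (inverse a_hi) + 1) * log 2 (inverse \<epsilon>)"
proof -
  let ?X = "log 2 (inverse \<epsilon>)" and ?\<beta> = "log 2 (inverse a_hi)"
  have q: "0 < ?X / ?\<beta>"
    using assms log_inverse_a_hi_pos by simp
  then show "1 \<le> cutoff \<epsilon>"
    unfolding cutoff_def by linarith
  have "real (cutoff \<epsilon>) \<le> ?X / ?\<beta> + 1"
    using q unfolding cutoff_def by linarith
  then show "real (cutoff \<epsilon>) \<le> (1 / ?\<beta> + 1) * ?X"
    using assms by (simp add: distrib_right)
qed

text \<open>Weights are products of the rational a_i, and midpoints are quotients of integers
  because \<open>cells\<close> counts intervals; their products are the nonnegative output
  coefficients.\<close>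

lemma midpoint_net:
  fixes i :: "nat \<Rightarrow> nat"
  assumes rat: "\<forall>k\<ge>1. a k \<in> \<rat>" and K: "1 \<le> cutoff \<epsilon>"
  defines "c \<equiv> \<lambda>k. weight a k * midpoint_seq \<epsilon> i k"
  shows "net_computes (hat_sum_net c (cutoff \<epsilon>)) (phi a (midpoint_seq \<epsilon> i))"
    and "net_rational (hat_sum_net c (cutoff \<epsilon>))"
proof -
  have c: "0 \<le> c k" for k
    using weight_pos[of k] by (simp add: c_def midpoint_seq_def)
  have "phi a (midpoint_seq \<epsilon> i) = (\<lambda>x. \<Sum>k=1..cutoff \<epsilon>. c k * hat (2 ^ k * x - 2))"
    unfolding c_def by (intro ext phi_finite_support) (simp add: midpoint_seq_def)
  then show "net_computes (hat_sum_net c (cutoff \<epsilon>)) (phi a (midpoint_seq \<epsilon> i))"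
    using net_computes_hat_sum_net[OF K c] by simp
  have "weight a k \<in> \<rat>" for k
    unfolding weight_def using rat by (intro Rats_prod) auto
  then have "c k \<in> \<rat>" for k
    by (simp add: c_def midpoint_seq_def)
  then show "net_rational (hat_sum_net c (cutoff \<epsilon>))"
    by (rule net_rational_hat_sum_net)
qed

text \<open>The minimal cover by midpoints supplies the code, as its centres are finite sums of
  bumps. In the constants, 5 is the layer width, 30 the parameters per level, and the other factor
  bounds \<open>cutoff\<close> by a multiple of X.\<close>

lemma optimal_relu_codes:
  assumes rat: "\<forall>k\<ge>1. a k \<in> \<rat>"
  shows "\<exists>(W::nat) (K::real). \<forall>\<epsilon> X. dyadic \<epsilon> \<longrightarrow> \<epsilon> > 0 \<longrightarrow> X = log 2 (inverse \<epsilon>) \<longrightarrow> X > 1 \<longrightarrow>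
    int (optimal_bits \<epsilon> (phi_class a)) = \<lceil>entropy \<epsilon> (phi_class a)\<rceil> \<and>
    (\<exists>E R. fixed_length_code (phi_class a) (optimal_bits \<epsilon> (phi_class a)) E R \<and>
       distortion (phi_class a) E R \<le> ereal \<epsilon> \<and>
       (\<forall>\<sigma>. length \<sigma> = optimal_bits \<epsilon> (phi_class a) \<longrightarrow>
          (\<exists>net. net_computes net (R \<sigma>) \<and> net_rational net \<and> net_width net \<le> W \<and>
             real (net_depth net) \<le> K * X \<and> real (net_params net) \<le> K * X)))"
proof (rule exI[of _ 5], rule exI[of _ "30 * (1 / log 2 (inverse a_hi) + 1)"], intro allI impI conjI)
  fix \<epsilon> X :: real
  assume \<epsilon>: "0 < \<epsilon>" and X: "X = log 2 (inverse \<epsilon>)" "1 < X"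
  let ?K = "30 * (1 / log 2 (inverse a_hi) + 1)"
  let ?F = "(\<lambda>i. phi a (midpoint_seq \<epsilon> i)) ` grid \<epsilon>"
  have "phi a (\<lambda>_. 0) \<in> phi_class a"
    by (auto simp: phi_class_def unit_seqs_def)
  then have ne: "?F \<noteq> {}"
    using grid_covers[OF \<epsilon>] by blast
  have card: "card ?F = covering_number \<epsilon> (phi_class a)"
    by (simp add: card_midpoints[OF \<epsilon>] covering_number_phi_class[OF \<epsilon>] card_grid)
  note opt = optimal_bits_minimal_cover[OF ball_cover_midpoints[OF \<epsilon>] ne card]
  show "int (optimal_bits \<epsilon> (phi_class a)) = \<lceil>entropy \<epsilon> (phi_class a)\<rceil>"
    by (rule opt(1))
  obtain E R where ER: "fixed_length_code (phi_class a) (optimal_bits \<epsilon> (phi_class a)) E R"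
    "distortion (phi_class a) E R \<le> ereal \<epsilon>" "range R \<subseteq> ?F"
    using opt(2) by blast
  have net: "\<exists>net. net_computes net (R \<sigma>) \<and> net_rational net \<and> net_width net \<le> 5 \<and>
      real (net_depth net) \<le> ?K * X \<and> real (net_params net) \<le> ?K * X" for \<sigma>
  proof -
    obtain i where i: "R \<sigma> = phi a (midpoint_seq \<epsilon> i)"
      using ER(3) by blast
    note cut = cutoff_bounds[OF X(2)[unfolded X(1)], folded X(1)]
    let ?net = "hat_sum_net (\<lambda>k. weight a k * midpoint_seq \<epsilon> i k) (cutoff \<epsilon>)"
    have "30 * real (cutoff \<epsilon>) \<le> ?K * X"
      using cut(2) by linarith
    moreover have "real (net_params ?net) \<le> real (30 * cutoff \<epsilon>)"
      using net_params_hat_sum_net[OF cut(1)] of_nat_mono by blast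
    ultimately have "real (net_params ?net) \<le> ?K * X" "real (net_depth ?net) \<le> ?K * X"
      using net_depth_hat_sum_net[OF cut(1)] by auto
    then show ?thesis
      using midpoint_net[OF rat cut(1), of i] net_width_hat_sum_net unfolding i by blast
  qed
  show "\<exists>E R. fixed_length_code (phi_class a) (optimal_bits \<epsilon> (phi_class a)) E R \<and>
      distortion (phi_class a) E R \<le> ereal \<epsilon> \<and>
      (\<forall>\<sigma>. length \<sigma> = optimal_bits \<epsilon> (phi_class a) \<longrightarrow>
         (\<exists>net. net_computes net (R \<sigma>) \<and> net_rational net \<and> net_width net \<le> 5 \<and>
            real (net_depth net) \<le> ?K * X \<and> real (net_params net) \<le> ?K * X))"
    by (intro exI[of _ E] exI[of _ R] conjI allI impI ER(1,2) net)
qed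

end

theorem theorem4p3:
  fixes a :: "nat \<Rightarrow> real" and a_lo a_hi :: real
  assumes "1 / 2 < a_lo" and "a_hi < 1"
    and "\<forall>k\<ge>1. a_lo \<le> a k \<and> a k \<le> a_hi"
  shows
    "(\<forall>t\<in>unit_seqs. \<forall>x. summable (phi_term a t x)) \<and>
     (\<forall>t\<in>unit_seqs. \<forall>n\<ge>1.
        unif_norm (\<lambda>x. foldr (subdiv_op (level_mask a t)) [1..<Suc n] gvec x - Phi a t x)
          \<le> ereal (weight a (n + 1))) \<and>
     (\<forall>t\<in>unit_seqs. \<forall>s\<in>unit_seqs.
        unif_norm (\<lambda>x. phi a t x - phi a s x) = (SUP k\<in>{1..}. ereal (weight a k * \<bar>t k - s k\<bar>))) \<and>
     convergent (lower_mean a) \<and>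
     (\<forall>t\<in>unit_seqs. \<forall>N U. is_norm N \<longrightarrow> orthonormal_kernel_basis matching_map U \<longrightarrow>
        (\<forall>m. bdd_above (chron_max N (level_mask a t) U m ` {1..})) \<and>
        convergent (\<lambda>m. root m (chron_sup N (level_mask a t) U m)) \<and>
        chron_radius N (level_mask a t) U = 2 powr (- lambda_u a) \<and>
        chron_radius N (level_mask a t) U \<le> a_hi) \<and>
     (\<forall>\<epsilon>>0. \<exists>F. ball_cover \<epsilon> (phi_class a) F) \<and>
     (\<forall>\<epsilon> X. \<epsilon> > 0 \<longrightarrow> X = log 2 (inverse \<epsilon>) \<longrightarrow> X > 1 \<longrightarrow>
        (\<exists>R. entropy \<epsilon> (phi_class a) = (\<Sum>j. max (X - 1 - logsum a j) 0) + R \<and>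
             0 \<le> R \<and> R \<le> 1 / ((1 - a_hi) * ln 2))) \<and>
     (\<forall>l. (\<lambda>n. logsum a n / real n) \<longlonglongrightarrow> l \<longrightarrow>
        (\<lambda>\<epsilon>. entropy \<epsilon> (phi_class a) - (log 2 (inverse \<epsilon>))\<^sup>2 / (2 * l))
          \<in> o[at_right 0](\<lambda>\<epsilon>. (log 2 (inverse \<epsilon>))\<^sup>2) \<and>
        (bdd_above (range (\<lambda>n. \<bar>logsum a n - l * real n\<bar>)) \<longrightarrow>
           (\<lambda>\<epsilon>. entropy \<epsilon> (phi_class a) - (log 2 (inverse \<epsilon>))\<^sup>2 / (2 * l))
             \<in> O[at_right 0](\<lambda>\<epsilon>. log 2 (inverse \<epsilon>)))) \<and>
     ((\<forall>k\<ge>1. a k \<in> \<rat>) \<longrightarrow> computable_rat_seq a \<longrightarrow>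
        (\<exists>(W::nat) (K::real). \<forall>\<epsilon> X. dyadic \<epsilon> \<longrightarrow> \<epsilon> > 0 \<longrightarrow> X = log 2 (inverse \<epsilon>) \<longrightarrow> X > 1 \<longrightarrow>
           int (optimal_bits \<epsilon> (phi_class a)) = \<lceil>entropy \<epsilon> (phi_class a)\<rceil> \<and>
           (\<exists>E R. fixed_length_code (phi_class a) (optimal_bits \<epsilon> (phi_class a)) E R \<and>
              distortion (phi_class a) E R \<le> ereal \<epsilon> \<and>
              (\<forall>\<sigma>. length \<sigma> = optimal_bits \<epsilon> (phi_class a) \<longrightarrow>
                 (\<exists>net. net_computes net (R \<sigma>) \<and> net_rational net \<and> net_width net \<le> W \<and>
                    real (net_depth net) \<le> K * X \<and> real (net_params net) \<le> K * X)))))"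
proof -
  interpret contraction_seq a a_lo a_hi
    using assms by unfold_locales auto
  show ?thesis
  proof (intro conjI ballI allI impI)
    fix t :: "nat \<Rightarrow> real" and N :: "real^3^3 \<Rightarrow> real" and U :: "real^3^4"
    assume t: "t \<in> unit_seqs" and N: "is_norm N" and U: "orthonormal_kernel_basis matching_map U"
    note lim = chron_radius_level_mask(2)[OF t N U]
    then show "convergent (\<lambda>m. root m (chron_sup N (level_mask a t) U m))"
      by (rule convergentI)
    show eq: "chron_radius N (level_mask a t) U = 2 powr (- lambda_u a)"
      unfolding chron_radius_def by (rule limI[OF lim])
    show "chron_radius N (level_mask a t) U \<le> a_hi"
      unfolding eq by (rule powr_lambda_u_le)
  next
    fix \<epsilon> X :: real
    assume "0 < \<epsilon>" "X = log 2 (inverse \<epsilon>)"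
    then show "\<exists>R. entropy \<epsilon> (phi_class a) = (\<Sum>j. max (X - 1 - logsum a j) 0) + R \<and>
        0 \<le> R \<and> R \<le> 1 / ((1 - a_hi) * ln 2)"
      using entropy_phi_class[of \<epsilon>]
      by (intro exI[of _ "entropy \<epsilon> (phi_class a) - ramp_sum (X - 1)"]) (auto simp: ramp_sum_def)
  next
    fix \<epsilon> :: real
    assume "0 < \<epsilon>"
    then show "\<exists>F. ball_cover \<epsilon> (phi_class a) F"
      using ball_cover_midpoints by blast
  qed (simp_all only: summable_phi_term unif_norm_cascade unif_norm_phi_diff convergent_lower_mean
      chron_radius_level_mask(1) entropy_smallo entropy_bigo
      optimal_relu_codes)
qed

end
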